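(* Let $\mathbf m=(m_1,m_2,\dots)$ be a type and $i\ge1$ an index with $m_i\neq0$ and $m_{i+1}\neq 0$. Let $v\in\mathcal W_n$ be a packed word of type $\vee_i\mathbf m$. Then $$\mathrm{sw}(v)\, e_{p_i(\mathbf m)}(x_1,\dots,x_n)=\sum_u \mathrm{sw}(u),$$ where the sum is over all words $u\in\mathcal W_n$ of type $\mathbf m$ such that $v=\vee_i u$.
   Context: Fix a positive integer $n$. Sites are elements of $\mathbb{Z}/n\mathbb{Z}$, identified with $1,\dots,n$, arranged cyclically. $\mathcal{W}_n$ is the set of words $u=u_1\cdots u_n$ with letters in $\{1,2,\dots\}$; $1^n$ is the all-$1$ word. The type of $u$ is $\mathbf m=(m_1,m_2,\dots)$ with $m_i$ the number of letters equal to $i$; $\ell=\max\{i:m_i\ne0\}$ is the number of classes; $u$ is packed if $m_i\neq 0$ for $1\le i\le\ell$. $p_i(\mathbf m)=m_1+\cdots+m_i$. The merge $\vee_i u$ is the word obtained from $u$ by decreasing every letter greater than $i$ by $1$; for types, $\vee_i\mathbf m=(m_1,\dots,m_{i-1},m_i+m_{i+1},m_{i+2},\dots)$. A queue is a subset $q\subseteq\{1,\dots,n\}$; an $r$-queue has size $r$. For a queue $q$ and $u\in\mathcal W_n$, $v=q(u)$ is defined by: choose a permutation $(i_1,\dots,i_n)$ of $(1,\dots,n)$ with $u_{i_1}\le\cdots\le u_{i_n}$; Phase I: for $i=i_n,\dots,i_{|q|+1}$ in this order, take the first site $j$ weakly to the left of $i$ (cyclically) with $j\notin q$ and $v_j$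 unset, and set $v_j=u_i+1$; Phase II: for $i=i_1,\dots,i_{|q|}$ in this order, take the first site $j$ weakly to the right of $i$ (cyclically) with $j\in q$ and $v_j$ unset, and set $v_j=u_i$. An (ordinary) MLQ of type $\mathbf m=(m_1,\dots,m_\ell,0,\dots)$ with $p_\ell(\mathbf m)=n$ is a sequence $\mathbf q=(q_1,\dots,q_{\ell-1})$ with $q_i$ a $p_i(\mathbf m)$-queue, acting by $\mathbf q(u)=q_{\ell-1}(\cdots q_1(u)\cdots)$. With indeterminates $x_1,\dots,x_n$, $\mathrm{wt}(\mathbf q)=\prod_{i}\prod_{j\in q_i}x_j$. For a packed word $u$ of type $\mathbf m$, the spectral weight is $\mathrm{sw}(u)=\sum\mathrm{wt}(\mathbf q)$ over all MLQs $\mathbf q$ of type $\mathbf m$ with $\mathbf q(1^n)=u$. $e_k$ denotes the elementary symmetric polynomial. *)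

theory Defs
  imports Main "HOL-Library.FuncSet" "HOL-Library.Poly_Mapping"
begin

text \<open>Sites are \<open>1, \<dots>, n\<close>; words are extensional functions on \<open>{1..n}\<close>, so that equality of
  words is equality of their letters. Types are functions on \<open>nat\<close>, of which only the indices
  from \<open>1\<close> on are meaningful: a word has no letter \<open>0\<close>, hence its type vanishes at \<open>0\<close>.\<close>

definition words :: "nat \<Rightarrow> (nat \<Rightarrow> nat) set" where
  "words n = {1..n} \<rightarrow>\<^sub>E {1..}"

definition ones :: "nat \<Rightarrow> nat \<Rightarrow> nat" where
  "ones n = (\<lambda>j\<in>{1..n}. 1)"

definition word_type :: "nat \<Rightarrow> (nat \<Rightarrow> nat) \<Rightarrow> nat \<Rightarrow> nat" where
  "word_type n u k = card {j \<in> {1..n}. u j = k}"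

definition num_classes :: "(nat \<Rightarrow> nat) \<Rightarrow> nat" where
  "num_classes m = Max {k. m k \<noteq> 0}"

definition packed :: "nat \<Rightarrow> (nat \<Rightarrow> nat) \<Rightarrow> bool" where
  "packed n u \<longleftrightarrow> (\<forall>k\<in>{1..num_classes (word_type n u)}. word_type n u k \<noteq> 0)"

definition psum :: "(nat \<Rightarrow> nat) \<Rightarrow> nat \<Rightarrow> nat" where
  "psum m i = (\<Sum>k=1..i. m k)"

definition merge_word :: "nat \<Rightarrow> nat \<Rightarrow> (nat \<Rightarrow> nat) \<Rightarrow> nat \<Rightarrow> nat" where
  "merge_word n i u = (\<lambda>j\<in>{1..n}. if u j > i then u j - 1 else u j)"

definition merge_type :: "nat \<Rightarrow> (nat \<Rightarrow> nat) \<Rightarrow> nat \<Rightarrow> nat" where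
  "merge_type i m k =
     (if k < i then m k else if k = i then m i + m (i + 1) else m (k + 1))"

text \<open>For sites \<open>i\<close> and \<open>j\<close>, the number of cyclic steps to the left from \<open>i\<close> to \<open>j\<close> is
  \<open>(i + n - j) mod n\<close>. It is injective in \<open>j \<in> {1..n}\<close>, so the minimizer is unique.\<close>

definition first_left :: "nat \<Rightarrow> nat set \<Rightarrow> nat \<Rightarrow> nat" where
  "first_left n S i = arg_min_on (\<lambda>j. (i + n - j) mod n) S"

definition first_right :: "nat \<Rightarrow> nat set \<Rightarrow> nat \<Rightarrow> nat" where
  "first_right n S i = arg_min_on (\<lambda>j. (j + n - i) mod n) S"

text \<open>During the two phases the word under construction is a partial map, with \<open>None\<close> for
  letters that are still unset.\<close>

definition phase1_step ::
  "nat \<Rightarrow> nat set \<Rightarrow> (nat \<Rightarrow> nat) \<Rightarrow> nat \<Rightarrow> (nat \<rightharpoonup> nat) \<Rightarrow> (nat \<rightharpoonup> nat)" where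
  "phase1_step n q u i v = v(first_left n {j \<in> {1..n}. j \<notin> q \<and> v j = None} i \<mapsto> u i + 1)"

definition phase2_step ::
  "nat \<Rightarrow> nat set \<Rightarrow> (nat \<Rightarrow> nat) \<Rightarrow> nat \<Rightarrow> (nat \<rightharpoonup> nat) \<Rightarrow> (nat \<rightharpoonup> nat)" where
  "phase2_step n q u i v = v(first_right n {j \<in> {1..n}. j \<in> q \<and> v j = None} i \<mapsto> u i)"

definition queue_order :: "nat \<Rightarrow> (nat \<Rightarrow> nat) \<Rightarrow> nat list \<Rightarrow> bool" where
  "queue_order n u js \<longleftrightarrow> distinct js \<and> set js = {1..n} \<and> sorted (map u js)"

definition queue_act_order ::
  "nat \<Rightarrow> nat set \<Rightarrow> (nat \<Rightarrow> nat) \<Rightarrow> nat list \<Rightarrow> nat \<Rightarrow> nat" where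
  "queue_act_order n q u js =
     (let v1 = fold (phase1_step n q u) (rev (drop (card q) js)) Map.empty;
          v2 = fold (phase2_step n q u) (take (card q) js) v1
      in (\<lambda>j\<in>{1..n}. the (v2 j)))"

text \<open>The order in which sites with equal letters are treated does not affect the result, so any
  choice of a sorting permutation gives the same word.\<close>

definition queue_act :: "nat \<Rightarrow> nat set \<Rightarrow> (nat \<Rightarrow> nat) \<Rightarrow> nat \<Rightarrow> nat" where
  "queue_act n q u = queue_act_order n q u (SOME js. queue_order n u js)"

text \<open>The entry at list position \<open>k - 1\<close> is the queue \<open>q\<^sub>k\<close>.\<close>

definition mlqs :: "nat \<Rightarrow> (nat \<Rightarrow> nat) \<Rightarrow> nat set list set" where
  "mlqs n m = {qs. length qs = num_classes m - 1 \<and>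
     (\<forall>k\<in>{1..<num_classes m}. qs ! (k - 1) \<subseteq> {1..n} \<and> card (qs ! (k - 1)) = psum m k)}"

definition mlq_act :: "nat \<Rightarrow> nat set list \<Rightarrow> (nat \<Rightarrow> nat) \<Rightarrow> nat \<Rightarrow> nat" where
  "mlq_act n qs u = fold (queue_act n) qs u"

text \<open>Integer polynomials in indeterminates indexed by \<open>nat\<close>: finitely supported maps from
  exponent vectors to coefficients, with the convolution product.\<close>

type_synonym mpoly = "(nat \<Rightarrow>\<^sub>0 nat) \<Rightarrow>\<^sub>0 int"

definition indet :: "nat \<Rightarrow> mpoly" where
  "indet j = Poly_Mapping.single (Poly_Mapping.single j 1) 1"

definition wt :: "nat set list \<Rightarrow> mpoly" where
  "wt qs = (\<Prod>q\<leftarrow>qs. \<Prod>j\<in>q. indet j)"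

definition spectral_weight :: "nat \<Rightarrow> (nat \<Rightarrow> nat) \<Rightarrow> mpoly" where
  "spectral_weight n u =
     (\<Sum>qs \<in> {qs \<in> mlqs n (word_type n u). mlq_act n qs (ones n) = u}. wt qs)"

definition elem_sym :: "nat \<Rightarrow> nat \<Rightarrow> mpoly" where
  "elem_sym n k = (\<Sum>S \<in> {S. S \<subseteq> {1..n} \<and> card S = k}. \<Prod>j\<in>S. indet j)"

end

theory Submission
  imports Defs
begin

text \<open>
  A queue acts on a word through the level sets \<open>{j. u j \<le> k}\<close>: a level set smaller than the queue
  is served by Phase II, a larger one by Phase I, and the queue itself is inserted as a new
  level set. On a single level set, Phase II is a periodic discrete-time queue with arrivals \<open>U\<close>,
  service times \<open>A\<close> and departures \<open>D\<close>, hence characterised by its queue lengths.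

  Two consecutive queues \<open>A\<close>, \<open>B\<close> with \<open>card A < card B\<close> can be exchanged: if \<open>B'\<close> is the set
  of departures from \<open>B\<close> with arrivals \<open>A\<close>, then \<open>A' = A \<union> (B - B')\<close> followed by \<open>B'\<close> acts like \<open>A\<close>
  followed by \<open>B\<close> (a Yang-Baxter equation, verified site by site), and
  \<open>(A, B) \<mapsto> (A', B')\<close> is a weight-preserving bijection. So in the sum over the multiline queues of
  type \<open>m\<close> the queue of size \<open>psum m i\<close> may be applied first. Merging commutes with queues and
  turns the word produced by this first queue back into \<open>1\<^sup>n\<close>, so the first queue
  contributes a free factor, the elementary symmetric polynomial.
\<close>

section \<open>Periodic queues\<close>

text \<open>\<open>Q t\<close> is the number of customers carried from site \<open>t\<close> to site \<open>t + 1\<close>; the indices \<open>0\<close> and \<open>n\<close>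
  denote the same site.\<close>

definition queue_length :: "nat \<Rightarrow> nat set \<Rightarrow> nat set \<Rightarrow> nat set \<Rightarrow> (nat \<Rightarrow> nat) \<Rightarrow> bool" where
  "queue_length n U A D Q \<longleftrightarrow> Q 0 = Q n \<and>
     (\<forall>t<n. Q (Suc t) + of_bool (Suc t \<in> D) = Q t + of_bool (Suc t \<in> U) \<and>
        (Suc t \<in> A - D \<longrightarrow> Q (Suc t) = 0))"

text \<open>A cycle has no first site at which to start the queue empty, so periodic queue lengths
  are asked to exist instead of being computed from an initial value.\<close>

definition serve :: "nat \<Rightarrow> nat set \<Rightarrow> nat set \<Rightarrow> nat set \<Rightarrow> bool" where
  "serve n U A D \<longleftrightarrow> U \<subseteq> {1..n} \<and> A \<subseteq> {1..n} \<and> D \<subseteq> A \<and> (\<exists>Q. queue_length n U A D Q)"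

lemma card_eq_sum_of_bool:
  assumes "U \<subseteq> {1..n}"
  shows "card U = (\<Sum>t<n. of_bool (Suc t \<in> U))"
proof -
  have "(\<Sum>t<n. of_bool (Suc t \<in> U)) = card {t\<in>{..<n}. Suc t \<in> U}"
    by (simp add: Int_def)
  also have "\<dots> = card (Suc ` {t\<in>{..<n}. Suc t \<in> U})"
    by (simp add: card_image)
  also have "Suc ` {t\<in>{..<n}. Suc t \<in> U} = U"
  proof (intro equalityI subsetI)
    fix x assume "x \<in> U"
    then show "x \<in> Suc ` {t\<in>{..<n}. Suc t \<in> U}"
      using assms by (cases x) auto
  qed auto
  finally show ?thesis by simp
qed

text \<open>The balance equation telescopes around the cycle, because
  \<open>Q 0 = Q n\<close>.\<close>

lemma serve_card:
  assumes "serve n U A D"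
  shows "card D = card U"
proof -
  obtain Q where Q: "queue_length n U A D Q" using assms by (auto simp: serve_def)
  have "(\<Sum>t<k. of_bool (Suc t \<in> D)) + Q k = (\<Sum>t<k. of_bool (Suc t \<in> U)) + Q 0" if "k \<le> n" for k
    using that
  proof (induction k)
    case (Suc k)
    then have "Q (Suc k) + of_bool (Suc k \<in> D) = Q k + of_bool (Suc k \<in> U)"
      using Q by (simp add: queue_length_def)
    with Suc show ?case by simp
  qed simp
  from this[of n] have "(\<Sum>t<n. of_bool (Suc t \<in> D)) = (\<Sum>t<n. of_bool (Suc t \<in> U) :: nat)"
    using Q by (simp add: queue_length_def)
  then show ?thesis
    using card_eq_sum_of_bool[of D n] card_eq_sum_of_bool[of U n] assms
    by (auto simp: serve_def)
qed

text \<open>Lindley's recursion: since a service is wasted only on an empty queue, the departures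
  can be eliminated. What remains is monotone in the current length and determined by
  \<open>Q 0\<close>.\<close>

lemma queue_length_Suc:
  assumes "queue_length n U A D Q" "D \<subseteq> A" "t < n"
  shows "Q (Suc t) = Q t + of_bool (Suc t \<in> U) - of_bool (Suc t \<in> A)"
proof -
  have "Q (Suc t) + of_bool (Suc t \<in> D) = Q t + of_bool (Suc t \<in> U)"
    "Suc t \<in> A - D \<longrightarrow> Q (Suc t) = 0"
    using assms by (auto simp: queue_length_def)
  then show ?thesis using assms(2) by (auto simp: of_bool_def split: if_splits)
qed

text \<open>Lindley's recursion preserves the order of two initial lengths. With fewer customers
  than services, the larger solution wastes some service; both lengths vanish there and hence agree
  from there on.\<close>

lemma serve_unique:
  assumes 1: "serve n U A D" and 2: "serve n U A E" and "card U < card A"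
  shows "D = E"
proof -
  have le: "D' = E'" if S: "serve n U A D'" "serve n U A E'"
    "queue_length n U A D' Q" "queue_length n U A E' R" "Q 0 \<le> R 0" for D' E' Q R
  proof -
    have sub: "D' \<subseteq> A" "E' \<subseteq> A" using S by (auto simp: serve_def)
    note rec = queue_length_Suc[OF S(3) sub(1)] queue_length_Suc[OF S(4) sub(2)]
    have mono: "Q t \<le> R t" if "t \<le> n" for t
      using that
    proof (induction t)
      case (Suc t)
      then have "Q t + of_bool (Suc t \<in> U) \<le> R t + of_bool (Suc t \<in> U)" by simp
      then show ?case using Suc.prems rec[of t] by (metis Suc_le_lessD diff_le_mono)
    qed (use S in simp)
    have "card E' < card A" using serve_card[OF S(2)] \<open>card U < card A\<close> by simp
    then obtain s where "s \<in> A - E'" using sub(2) by (metis DiffI less_irrefl subset_antisym subsetI)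
    moreover from this have "s \<in> {1..n}" using S(1) by (auto simp: serve_def)
    then obtain s' where s': "s = Suc s'" "s' < n" by (cases s) auto
    ultimately have "R s = 0" using S(4) by (auto simp: queue_length_def)
    then have s0: "Q s = R s" using mono[of s] s' by simp
    \<comment> \<open>Agreement from \<open>s\<close> up to \<open>n\<close> is agreement at
      \<open>0\<close> by periodicity, and the recursion then carries it to all sites.\<close>
    have "Q t = R t" if "s \<le> t" "t \<le> n" for t
      using that
      by (induction rule: dec_induct) (use s0 rec in auto)
    then have "Q n = R n" using s' by simp
    then have "Q 0 = R 0" using S(3,4) by (simp add: queue_length_def)
    then have eq: "Q t = R t" if "t \<le> n" for t
      using that by (induction t) (use rec in auto)
    have "Suc t \<in> D' \<longleftrightarrow> Suc t \<in> E'" if "t < n" for t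
    proof -
      have "Q (Suc t) + of_bool (Suc t \<in> D') = Q t + of_bool (Suc t \<in> U)"
        "R (Suc t) + of_bool (Suc t \<in> E') = R t + of_bool (Suc t \<in> U)"
        using S(3,4) that by (simp_all add: queue_length_def)
      then have "of_bool (Suc t \<in> D') = (of_bool (Suc t \<in> E') :: nat)"
        using eq[of t] eq[of "Suc t"] that by simp
      then show ?thesis by (simp add: of_bool_def split: if_splits)
    qed
    moreover have "A \<subseteq> {1..n}" using S(1) by (auto simp: serve_def)
    ultimately have "j \<in> D' \<longleftrightarrow> j \<in> E'" if "j \<in> {1..n}" for j
      using that by (cases j) auto
    then show ?thesis using sub \<open>A \<subseteq> {1..n}\<close> by blast
  qed
  obtain Q R where "queue_length n U A D Q" "queue_length n U A E R"
    using 1 2 by (auto simp: serve_def)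
  then show ?thesis
    using le[OF 1 2] le[OF 2 1] by (metis nat_le_linear)
qed

section \<open>Adding one customer\<close>

lemma serve_empty: "A \<subseteq> {1..n} \<Longrightarrow> serve n {} A {}"
  by (auto simp: serve_def queue_length_def intro!: exI[of _ "\<lambda>_. 0"])

lemma mod_cyclic_distance:
  fixes x y n :: nat
  assumes "x \<in> {1..n}" "y \<in> {1..n}"
  shows "(y + n - x) mod n = (if x \<le> y then y - x else y + n - x)"
proof (cases "x \<le> y")
  case True
  then have "y + n - x = (y - x) + n" by simp
  then have "(y + n - x) mod n = (y - x) mod n" by simp
  also have "\<dots> = y - x" using assms by (intro mod_less) auto
  finally show ?thesis using True by simp
qed (use assms in auto)

text \<open>The new customer is carried from \<open>x\<close> rightwards to the first free service
  \<open>y\<close>, so all queue lengths on this arc grow by one.\<close>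

lemma serve_insert:
  assumes "serve n U A D" and x: "x \<in> {1..n} - U" and y: "y \<in> A - D"
    and first: "\<And>z. z \<in> A - D \<Longrightarrow> (y + n - x) mod n \<le> (z + n - x) mod n"
  shows "serve n (insert x U) A (insert y D)"
proof -
  obtain Q where Q: "queue_length n U A D Q" and A: "A \<subseteq> {1..n}" "D \<subseteq> A" "U \<subseteq> {1..n}"
    using assms(1) by (auto simp: serve_def)
  \<comment> \<open>The links \<open>t\<close> to \<open>t + 1\<close> used by the new customer. In
    the second case the arc passes from \<open>n\<close> to \<open>1\<close>, and \<open>arc\<close>
    holds at both \<open>0\<close> and \<open>n\<close>.\<close>
  define arc where "arc t \<longleftrightarrow> (if x \<le> y then x \<le> t \<and> t < y else t < y \<or> x \<le> t)" for t
  define Q' where "Q' t = Q t + of_bool (arc t)" for t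
  have yn: "y \<in> {1..n}" using y A by auto
  \<comment> \<open>A free service on the arc would be strictly closer to \<open>x\<close> than
    \<open>y\<close> is, so no queue that has to be empty is lengthened.\<close>
  have gap: "z \<notin> A - D" if "arc z" "z \<in> {1..n}" for z
  proof
    assume "z \<in> A - D"
    then have "(if x \<le> y then y - x else y + n - x) \<le> (if x \<le> z then z - x else z + n - x)"
      using first[of z] x yn that mod_cyclic_distance[of x n y] mod_cyclic_distance[of x n z] by simp
    then show False
      using that x yn by (auto simp: arc_def split: if_splits)
  qed
  have arc_Suc: "of_bool (arc (Suc t)) + of_bool (Suc t = y) = of_bool (arc t) + (of_bool (Suc t = x) :: nat)"
    if "t < n" for t
    using that x yn by (auto simp: arc_def of_bool_def)
  have "queue_length n (insert x U) A (insert y D) Q'"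
    unfolding queue_length_def
  proof (intro conjI allI impI)
    show "Q' 0 = Q' n" using Q x yn by (auto simp: queue_length_def Q'_def arc_def)
  next
    fix t assume t: "t < n"
    have "Q (Suc t) + of_bool (Suc t \<in> D) = Q t + of_bool (Suc t \<in> U)"
      using Q t by (simp add: queue_length_def)
    moreover have "of_bool (Suc t \<in> insert y D) = of_bool (Suc t \<in> D) + (of_bool (Suc t = y) :: nat)"
      "of_bool (Suc t \<in> insert x U) = of_bool (Suc t \<in> U) + (of_bool (Suc t = x) :: nat)"
      using x y by auto
    ultimately show "Q' (Suc t) + of_bool (Suc t \<in> insert y D) = Q' t + of_bool (Suc t \<in> insert x U)"
      using arc_Suc[OF t] by (simp only: Q'_def)
  next
    fix t assume t: "t < n" "Suc t \<in> A - insert y D"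
    then have "Q (Suc t) = 0" "\<not> arc (Suc t)" using Q gap[of "Suc t"] by (auto simp: queue_length_def)
    then show "Q' (Suc t) = 0" by (simp add: Q'_def)
  qed
  then show ?thesis using A x y by (auto simp: serve_def)
qed

text \<open>The mirror image turns the leftward search of Phase I into the rightward search of
  Phase II.\<close>

definition mirror :: "nat \<Rightarrow> nat \<Rightarrow> nat" where
  "mirror n j = n + 1 - j"

text \<open>Within \<open>{1..n}\<close> the map \<open>mirror n\<close> is injective, so the bounds
  let each set be recovered from its mirror image.\<close>

definition serve_left :: "nat \<Rightarrow> nat set \<Rightarrow> nat set \<Rightarrow> nat set \<Rightarrow> bool" where
  "serve_left n U A D \<longleftrightarrow> U \<subseteq> {1..n} \<and> A \<subseteq> {1..n} \<and> D \<subseteq> {1..n} \<and>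
     serve n (mirror n ` U) (mirror n ` A) (mirror n ` D)"

lemma inj_on_mirror: "inj_on (mirror n) {1..n}"
  by (auto simp: inj_on_def mirror_def)

lemma card_mirror: "U \<subseteq> {1..n} \<Longrightarrow> card (mirror n ` U) = card U"
  by (meson card_image inj_on_mirror inj_on_subset)

lemma serve_left_card: "serve_left n U A D \<Longrightarrow> card D = card U"
  unfolding serve_left_def using serve_card card_mirror by metis

lemma serve_left_unique:
  assumes "serve_left n U A D" "serve_left n U A E" "card U < card A"
  shows "D = E"
proof -
  have "mirror n ` D = mirror n ` E"
    using assms serve_unique[of n "mirror n ` U" "mirror n ` A"] by (auto simp: serve_left_def card_mirror)
  then show ?thesis
    using assms inj_on_image_eq_iff[OF inj_on_mirror, of D n E] by (auto simp: serve_left_def)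
qed

lemma serve_left_empty: "A \<subseteq> {1..n} \<Longrightarrow> serve_left n {} A {}"
  unfolding serve_left_def by (fastforce intro!: serve_empty simp: mirror_def)

lemma serve_left_insert:
  assumes S: "serve_left n U A D" and x: "x \<in> {1..n} - U" and y: "y \<in> A - D"
    and first: "\<And>z. z \<in> A - D \<Longrightarrow> (x + n - y) mod n \<le> (x + n - z) mod n"
  shows "serve_left n (insert x U) A (insert y D)"
proof -
  have sub: "U \<subseteq> {1..n}" "A \<subseteq> {1..n}" "D \<subseteq> {1..n}"
    and S': "serve n (mirror n ` U) (mirror n ` A) (mirror n ` D)"
    using S by (auto simp: serve_left_def)
  have dist: "mirror n z + n - mirror n x = x + n - z" if "z \<in> {1..n}" for z
    using that x by (auto simp: mirror_def)
  have diff: "mirror n ` A - mirror n ` D = mirror n ` (A - D)"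
    using sub inj_on_image_set_diff[OF inj_on_mirror, of A D n] by auto
  have yn: "y \<in> {1..n}" using y sub by auto
  have "serve n (insert (mirror n x) (mirror n ` U)) (mirror n ` A) (insert (mirror n y) (mirror n ` D))"
  proof (rule serve_insert[OF S'])
    show "mirror n x \<in> {1..n} - mirror n ` U"
      using x sub inj_on_image_mem_iff[OF inj_on_mirror, of x n U] by (auto simp: mirror_def)
    show "mirror n y \<in> mirror n ` A - mirror n ` D" using y diff by auto
  next
    fix z assume "z \<in> mirror n ` A - mirror n ` D"
    then obtain z' where "z = mirror n z'" "z' \<in> A - D" using diff by auto
    then show "(mirror n y + n - mirror n x) mod n \<le> (z + n - mirror n x) mod n"
      using first[of z'] dist[of z'] dist[OF yn] sub by auto
  qed
  then show ?thesis using sub x yn by (auto simp: serve_left_def)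
qed

lemma first_right:
  assumes "finite S" "S \<noteq> {}"
  shows "first_right n S i \<in> S"
    and "z \<in> S \<Longrightarrow> (first_right n S i + n - i) mod n \<le> (z + n - i) mod n"
  using arg_min_if_finite(1)[OF assms] arg_min_least[OF assms, of z "\<lambda>j. (j + n - i) mod n"]
  unfolding first_right_def by auto

lemma first_left:
  assumes "finite S" "S \<noteq> {}"
  shows "first_left n S i \<in> S"
    and "z \<in> S \<Longrightarrow> (i + n - first_left n S i) mod n \<le> (i + n - z) mod n"
  using arg_min_if_finite(1)[OF assms] arg_min_least[OF assms, of z "\<lambda>j. (i + n - j) mod n"]
  unfolding first_left_def by auto

lemma serve_first_right:
  assumes "serve n U A D" "x \<in> {1..n} - U" "D \<subset> A"
  shows "serve n (insert x U) A (insert (first_right n (A - D) x) D)"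
proof -
  have "finite (A - D)" "A - D \<noteq> {}"
    using assms by (auto simp: serve_def intro: finite_subset)
  note first_right[OF this]
  then show ?thesis using serve_insert assms by blast
qed

lemma serve_left_first_left:
  assumes "serve_left n U A D" "x \<in> {1..n} - U" "D \<subset> A"
  shows "serve_left n (insert x U) A (insert (first_left n (A - D) x) D)"
proof -
  have "finite (A - D)" "A - D \<noteq> {}"
    using assms by (auto simp: serve_left_def intro: finite_subset)
  note first_left[OF this]
  then show ?thesis using serve_left_insert assms by blast
qed

text \<open>Passing three letters \<open>u, a, b\<close> through a site changes three queue lengths.
  The combinatorial three-dimensional R-matrix (the solution of the tetrahedron equation)
  \<open>(r, q, p) \<mapsto> (q + (r - p)\<^sup>+, min r p, q + (p - r)\<^sup>+)\<close> translates the queue lengths of one order of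
  service into those of the other; this is the resulting local identity, with truncated
  subtraction as positive part.\<close>

lemma local_yang_baxter:
  fixes p p' q q' r r' :: nat and a b b' d d' e u :: bool
  assumes "p' + of_bool b' = p + of_bool a" "b \<and> \<not> b' \<Longrightarrow> p' = 0"
    and "q' + of_bool d' = q + of_bool u" "(a \<or> b \<and> \<not> b') \<and> \<not> d' \<Longrightarrow> q' = 0"
    and "r' + of_bool e = r + of_bool d'" "b' \<and> \<not> e \<Longrightarrow> r' = 0"
    and "b' \<Longrightarrow> b" "e \<Longrightarrow> b'" "d' \<Longrightarrow> a \<or> b \<and> \<not> b'"
    and "d \<longleftrightarrow> q' + (r' - p') + 1 = q + (r - p) + of_bool u"
  shows "q' + (r' - p') + of_bool d = q + (r - p) + of_bool u
     \<and> min r' p' + of_bool e = min r p + of_bool d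
     \<and> (d \<longrightarrow> a) \<and> (a \<and> \<not> d \<longrightarrow> q' + (r' - p') = 0) \<and> (b \<and> \<not> e \<longrightarrow> min r' p' = 0)"
  using assms
  by (cases a; cases b; cases b'; cases d'; cases e; cases u; simp add: min_def of_bool_def split: if_splits nat_diff_split)

text \<open>The R-matrix proposes the queue lengths for the other order of service; the local
  identity confirms them at every site.\<close>

lemma serve_yang_baxter:
  assumes "serve n A B B'" and "serve n U (A \<union> (B - B')) D'" and "serve n D' B' E"
  obtains D where "serve n U A D" and "serve n D B E"
proof -
  obtain p q r where p: "queue_length n A B B' p"
    and q: "queue_length n U (A \<union> (B - B')) D' q" and r: "queue_length n D' B' E r"
    using assms by (auto simp: serve_def)
  \<comment> \<open>The first two components of the R-matrix: \<open>x\<close> for \<open>U\<close>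
    served by \<open>A\<close>, \<open>y\<close> for the resulting departures served by
    \<open>B\<close>.\<close>
  define x where "x t = q t + (r t - p t)" for t
  define y where "y t = min (r t) (p t)" for t
  \<comment> \<open>The balance equation for \<open>x\<close> forces the departures: one takes place
    where \<open>x\<close> ends up one below the previous length plus arrival.\<close>
  define D where "D = {Suc t |t. t < n \<and> x (Suc t) + 1 = x t + of_bool (Suc t \<in> U)}"
  have sub: "U \<subseteq> {1..n}" "A \<subseteq> {1..n}" "B \<subseteq> {1..n}" "B' \<subseteq> B" "D' \<subseteq> A \<union> (B - B')" "E \<subseteq> B'"
    using assms by (auto simp: serve_def)
  have loc: "x (Suc t) + of_bool (Suc t \<in> D) = x t + of_bool (Suc t \<in> U)
     \<and> y (Suc t) + of_bool (Suc t \<in> E) = y t + of_bool (Suc t \<in> D)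
     \<and> (Suc t \<in> D \<longrightarrow> Suc t \<in> A) \<and> (Suc t \<in> A - D \<longrightarrow> x (Suc t) = 0)
     \<and> (Suc t \<in> B - E \<longrightarrow> y (Suc t) = 0)" if t: "t < n" for t
  proof -
    have D: "Suc t \<in> D \<longleftrightarrow> x (Suc t) + 1 = x t + of_bool (Suc t \<in> U)"
      using t by (auto simp: D_def)
    have P: "p (Suc t) + of_bool (Suc t \<in> B') = p t + of_bool (Suc t \<in> A)"
      "Suc t \<in> B - B' \<longrightarrow> p (Suc t) = 0"
      "q (Suc t) + of_bool (Suc t \<in> D') = q t + of_bool (Suc t \<in> U)"
      "Suc t \<in> A \<union> (B - B') - D' \<longrightarrow> q (Suc t) = 0"
      "r (Suc t) + of_bool (Suc t \<in> E) = r t + of_bool (Suc t \<in> D')"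
      "Suc t \<in> B' - E \<longrightarrow> r (Suc t) = 0"
      using p q r t by (auto simp: queue_length_def)
    have S: "Suc t \<in> B' \<longrightarrow> Suc t \<in> B" "Suc t \<in> E \<longrightarrow> Suc t \<in> B'"
      "Suc t \<in> D' \<longrightarrow> Suc t \<in> A \<or> (Suc t \<in> B \<and> Suc t \<notin> B')"
      using sub by auto
    show ?thesis
      unfolding Diff_iff x_def y_def
      by (rule local_yang_baxter[where b' = "Suc t \<in> B'" and d' = "Suc t \<in> D'"])
        (use P S D in \<open>auto simp: x_def\<close>)
  qed
  have "queue_length n U A D x" "queue_length n D B E y"
    using loc p q r by (auto simp: queue_length_def x_def y_def)
  moreover have "D \<subseteq> A" using loc by (auto simp: D_def)
  ultimately have "serve n U A D" "serve n D B E"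
    using sub by (auto simp: serve_def)
  then show ?thesis using that by blast
qed

text \<open>Customers are inserted one at a time; departures are as many as the customers treated so
  far, so a free service remains for the next one.\<close>

lemma serve_exists:
  assumes "U \<subseteq> {1..n}" "A \<subseteq> {1..n}" "card U \<le> card A"
  shows "\<exists>D. serve n U A D"
proof -
  have "finite U" using assms finite_subset by blast
  then show ?thesis using assms(1,3)
  proof (induction U rule: finite_induct)
    case empty
    then show ?case using serve_empty assms(2) by blast
  next
    case (insert x U)
    then obtain D where D: "serve n U A D" by auto
    then have "D \<subset> A"
      using serve_card[OF D] insert by (auto simp: serve_def)
    then show ?case using serve_first_right[OF D] insert by blast
  qed
qed

section \<open>The action of a queue on level sets\<close>

definition level :: "nat \<Rightarrow> (nat \<Rightarrow> nat) \<Rightarrow> nat \<Rightarrow> nat set" where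
  "level n u k = {j \<in> {1..n}. u j \<le> k}"

lemma level_subset: "level n u k \<subseteq> {1..n}"
  by (auto simp: level_def)

lemma finite_level [simp]: "finite (level n u k)"
  by (simp add: level_def)

lemma level_mono: "k \<le> l \<Longrightarrow> level n u k \<subseteq> level n u l"
  by (auto simp: level_def)

lemma card_level_mono: "k \<le> l \<Longrightarrow> card (level n u k) \<le> card (level n u l)"
  by (simp add: card_mono level_mono)

lemma level_0: "u \<in> words n \<Longrightarrow> level n u 0 = {}"
  by (auto simp: level_def words_def PiE_def Pi_def)

lemma words_eqI:
  assumes "u \<in> words n" "w \<in> words n" and lev: "\<And>k. k \<ge> 1 \<Longrightarrow> level n u k = level n w k"
  shows "u = w"
proof (rule PiE_ext)
  show "u \<in> {1..n} \<rightarrow>\<^sub>E {1..}" "w \<in> {1..n} \<rightarrow>\<^sub>E {1..}"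
    using assms by (auto simp: words_def)
next
  fix j assume j: "j \<in> {1..n}"
  then have "u j \<ge> 1" "w j \<ge> 1" using assms(1,2) by (auto simp: words_def PiE_def)
  moreover from this have "j \<in> level n w (u j)" "j \<in> level n u (w j)"
    using j lev[of "u j"] lev[of "w j"] by (auto simp: level_def)
  ultimately show "u j = w j" by (simp add: level_def)
qed

section \<open>Both phases as one greedy placement\<close>

definition greedy_step ::
  "(nat set \<Rightarrow> nat \<Rightarrow> nat) \<Rightarrow> nat set \<Rightarrow> (nat \<Rightarrow> nat) \<Rightarrow> nat \<Rightarrow> (nat \<rightharpoonup> nat) \<Rightarrow> (nat \<rightharpoonup> nat)" where
  "greedy_step pick T f i v = v(pick {j \<in> T. v j = None} i \<mapsto> f i)"

text \<open>\<open>C\<close> is an invariant between the sites treated and the targets occupied, to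
  be instantiated by \<open>serve\<close> and \<open>serve_left\<close>. The length bound guarantees
  a free target at each step.\<close>

lemma greedy_fold:
  fixes f :: "nat \<Rightarrow> nat"
  assumes T: "finite T" and C0: "C {} {}"
    and pick: "\<And>S i. finite S \<Longrightarrow> S \<noteq> {} \<Longrightarrow> pick S i \<in> S"
    and C: "\<And>U D x. C U D \<Longrightarrow> x \<in> N - U \<Longrightarrow> D \<subset> T \<Longrightarrow> C (insert x U) (insert (pick (T - D) x) D)"
    and v0: "dom v0 \<inter> T = {}"
    and xs: "distinct xs" "set xs \<subseteq> N" "length xs \<le> card T"
  defines "v \<equiv> fold (greedy_step pick T f) xs v0"
  shows "(\<forall>j. j \<notin> T \<longrightarrow> v j = v0 j) \<and> (\<forall>j\<in>T. \<forall>a. v j = Some a \<longrightarrow> a \<in> f ` set xs)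
    \<and> card (dom v \<inter> T) = length xs \<and> C (set xs) (dom v \<inter> T)"
  using xs unfolding v_def
proof (induction xs rule: rev_induct)
  case Nil
  then show ?case using v0 C0 by auto
next
  case (snoc x xs)
  define w where "w = fold (greedy_step pick T f) xs v0"
  have IH: "\<forall>j. j \<notin> T \<longrightarrow> w j = v0 j" "\<forall>j\<in>T. \<forall>a. w j = Some a \<longrightarrow> a \<in> f ` set xs"
    "card (dom w \<inter> T) = length xs" "C (set xs) (dom w \<inter> T)"
    using snoc by (auto simp: w_def)
  define S where "S = {j \<in> T. w j = None}"
  have S: "S = T - dom w \<inter> T" by (auto simp: S_def)
  have D: "dom w \<inter> T \<subset> T"
    using IH(3) snoc.prems(3) by auto
  then have "S \<noteq> {}" "finite S" using S T by auto
  then have p: "pick S x \<in> S" using pick by blast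
  have eq: "fold (greedy_step pick T f) (xs @ [x]) v0 = w(pick S x \<mapsto> f x)"
    by (simp add: w_def greedy_step_def S_def)
  have dom: "dom (w(pick S x \<mapsto> f x)) \<inter> T = insert (pick S x) (dom w \<inter> T)"
    using p by (auto simp: S_def)
  have "C (insert x (set xs)) (insert (pick S x) (dom w \<inter> T))"
    using C[OF IH(4) _ D, of x] snoc.prems S by auto
  moreover have "card (insert (pick S x) (dom w \<inter> T)) = Suc (length xs)"
    using p T IH(3) S by (subst card_insert_disjoint) auto
  ultimately show ?case
    unfolding eq dom using IH p by (auto simp: S_def)
qed

text \<open>Later steps neither overwrite earlier letters nor produce letters satisfying the predicate,
  so the letters satisfying it are those placed by the initial segment.\<close>

lemma greedy_fold_split:
  fixes f :: "nat \<Rightarrow> nat"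
  assumes T: "finite T" and C0: "C {} {}"
    and pick: "\<And>S i. finite S \<Longrightarrow> S \<noteq> {} \<Longrightarrow> pick S i \<in> S"
    and C: "\<And>U D x. C U D \<Longrightarrow> x \<in> N - U \<Longrightarrow> D \<subset> T \<Longrightarrow> C (insert x U) (insert (pick (T - D) x) D)"
    and v0: "dom v0 \<inter> T = {}"
    and xs: "distinct (xs @ ys)" "set (xs @ ys) \<subseteq> N" "length (xs @ ys) \<le> card T"
    and P: "\<And>x. x \<in> set xs \<Longrightarrow> P (f x)" "\<And>y. y \<in> set ys \<Longrightarrow> \<not> P (f y)"
  shows "C (set xs) {j \<in> T. \<exists>a. fold (greedy_step pick T f) (xs @ ys) v0 j = Some a \<and> P a}"
  using xs P
proof (induction ys rule: rev_induct)
  case Nil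
  note gf = greedy_fold[of T C pick N v0 xs f, OF T C0 pick C v0]
  have "{j \<in> T. \<exists>a. fold (greedy_step pick T f) xs v0 j = Some a \<and> P a}
      = dom (fold (greedy_step pick T f) xs v0) \<inter> T"
    using gf Nil by fastforce
  then show ?case using gf Nil by simp
next
  case (snoc y ys)
  define w where "w = fold (greedy_step pick T f) (xs @ ys) v0"
  have IH: "C (set xs) {j \<in> T. \<exists>a. w j = Some a \<and> P a}"
    using snoc by (auto simp: w_def)
  have card: "card (dom w \<inter> T) = length (xs @ ys)"
    using greedy_fold[of T C pick N v0 "xs @ ys" f, OF T C0 pick C v0] snoc.prems by (simp add: w_def)
  define S where "S = {j \<in> T. w j = None}"
  have "dom w \<inter> T \<noteq> T"
    using card snoc.prems(3) by auto
  then have "S \<noteq> {}" "finite S" using T by (auto simp: S_def)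
  then have p: "pick S y \<in> S" using pick by blast
  have eq: "fold (greedy_step pick T f) (xs @ ys @ [y]) v0 = w(pick S y \<mapsto> f y)"
    by (simp add: w_def greedy_step_def S_def)
  have "{j \<in> T. \<exists>a. (w(pick S y \<mapsto> f y)) j = Some a \<and> P a} = {j \<in> T. \<exists>a. w j = Some a \<and> P a}"
    using p snoc.prems(5)[of y] by (auto simp: S_def)
  then show ?case using IH unfolding eq by simp
qed

lemma phase1_step_eq: "phase1_step n q u = greedy_step (first_left n) ({1..n} - q) (\<lambda>i. u i + 1)"
  by (auto simp: fun_eq_iff phase1_step_def greedy_step_def intro!: arg_cong2[where f = "\<lambda>S. first_left n S"])

lemma phase2_step_eq:
  assumes "q \<subseteq> {1..n}"
  shows "phase2_step n q u = greedy_step (first_right n) q u"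
proof -
  have "{j \<in> {1..n}. j \<in> q \<and> v j = None} = {j \<in> q. v j = None}" for v :: "nat \<rightharpoonup> nat"
    using assms by auto
  then show ?thesis by (simp add: fun_eq_iff phase2_step_def greedy_step_def)
qed

text \<open>However ties are broken, sorting puts a whole level set first; this is why the chosen
  order does not influence the level sets of the result.\<close>

lemma sorted_level_split:
  assumes "queue_order n u js"
  obtains xs ys where "js = xs @ ys" "set xs = level n u k" "set ys = {1..n} - level n u k"
    "length xs = card (level n u k)"
proof -
  define xs where "xs = takeWhile (\<lambda>j. u j \<le> k) js"
  define ys where "ys = dropWhile (\<lambda>j. u j \<le> k) js"
  have js: "js = xs @ ys" by (simp add: xs_def ys_def)
  have o: "distinct js" "set js = {1..n}" "sorted (map u js)" using assms by (auto simp: queue_order_def)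
  have x: "u j \<le> k" if "j \<in> set xs" for j using that by (auto simp: xs_def dest: set_takeWhileD)
  have y: "\<not> u j \<le> k" if "j \<in> set ys" for j
  proof (cases ys)
    case (Cons z zs)
    then have "\<not> u z \<le> k" using hd_dropWhile[of "\<lambda>j. u j \<le> k" js] by (simp add: ys_def)
    moreover have "sorted (map u ys)" using o(3) js by (simp add: sorted_append)
    then have "u z \<le> u j" using that Cons by auto
    ultimately show ?thesis by simp
  qed (use that in simp)
  have "set xs = level n u k" "set ys = {1..n} - level n u k"
    using x y o js by (auto simp: level_def)
  moreover have "length xs = card (set xs)" using o(1) js by (metis distinct_append distinct_card)
  ultimately show ?thesis using that js by simp
qed

lemma queue_order_exists: "\<exists>js. queue_order n u js"
  by (rule exI[of _ "sort_key u [1..<n + 1]"]) (auto simp: queue_order_def)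

text \<open>Phase II starts with the smallest letters, so a level set smaller than the queue is
  served undisturbed; Phase I starts with the largest, so the same holds for the complement of a
  level set larger than the queue. Phase I raises letters by one, whence the index
  \<open>k + 1\<close>.\<close>

lemma queue_act_levels:
  assumes u: "u \<in> words n" and q: "q \<subseteq> {1..n}"
  defines "v \<equiv> queue_act n q u"
  shows queue_act_words: "v \<in> words n"
    and queue_act_level_serve: "card (level n u k) < card q \<Longrightarrow> serve n (level n u k) q (level n v k)"
    and queue_act_level_queue: "card (level n u k) \<le> card q \<Longrightarrow> card q \<le> card (level n u (k + 1)) \<Longrightarrow>
      level n v (k + 1) = q"
    and queue_act_level_serve_left: "card q < card (level n u k) \<Longrightarrow>
      serve_left n ({1..n} - level n u k) ({1..n} - q) ({1..n} - level n v (k + 1))"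
proof -
  define js where "js = (SOME js. queue_order n u js)"
  have js: "queue_order n u js" unfolding js_def using queue_order_exists by (rule someI_ex)
  then have o: "distinct js" "set js = {1..n}" by (auto simp: queue_order_def)
  then have len: "length js = n" using distinct_card by fastforce
  define c where "c = card q"
  have c: "c \<le> n" using q card_mono[of "{1..n}" q] by (simp add: c_def)
  let ?T = "{1..n} - q"
  have fin: "finite q" using q finite_subset by blast
  have cT: "card ?T = n - c" using q fin by (simp add: card_Diff_subset c_def)
  define v1 where "v1 = fold (greedy_step (first_left n) ?T (\<lambda>i. u i + 1)) (rev (drop c js)) Map.empty"
  define v2 where "v2 = fold (greedy_step (first_right n) q u) (take c js) v1"
  have v: "v = (\<lambda>j\<in>{1..n}. the (v2 j))"
    unfolding v_def queue_act_def queue_act_order_def js_def[symmetric]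
    by (simp add: Let_def v2_def v1_def phase1_step_eq phase2_step_eq[OF q] c_def)
  have step1: "serve_left n (insert x U) ?T (insert (first_left n (?T - D) x) D)"
    if "serve_left n U ?T D" "x \<in> {1..n} - U" "D \<subset> ?T" for U D x
    using serve_left_first_left that by blast
  have step2: "serve n (insert x U) q (insert (first_right n (q - D) x) D)"
    if "serve n U q D" "x \<in> {1..n} - U" "D \<subset> q" for U D x
    using serve_first_right that by blast
  have sub: "set (drop c js) \<subseteq> {1..n}" "set (take c js) \<subseteq> {1..n}"
    using o set_drop_subset set_take_subset by fastforce+
  have dist: "distinct (rev (drop c js))" "distinct (take c js)" using o by auto
  have v1: "(\<forall>j. j \<notin> ?T \<longrightarrow> v1 j = None) \<and> (\<forall>j\<in>?T. \<forall>a. v1 j = Some a \<longrightarrow> a \<in> (\<lambda>i. u i + 1) ` set (rev (drop c js)))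
    \<and> card (dom v1 \<inter> ?T) = length (rev (drop c js)) \<and> serve_left n (set (rev (drop c js))) ?T (dom v1 \<inter> ?T)"
    unfolding v1_def
    by (rule greedy_fold[where N = "{1..n}"])
      (use serve_left_empty step1 first_left(1) dist sub len cT in auto)
  have d1: "dom v1 \<inter> q = {}" using v1 by auto
  have v2: "(\<forall>j. j \<notin> q \<longrightarrow> v2 j = v1 j) \<and> (\<forall>j\<in>q. \<forall>a. v2 j = Some a \<longrightarrow> a \<in> u ` set (take c js))
    \<and> card (dom v2 \<inter> q) = length (take c js) \<and> serve n (set (take c js)) q (dom v2 \<inter> q)"
    unfolding v2_def
    by (rule greedy_fold[where N = "{1..n}"])
      (use serve_empty q fin step2 first_right(1) dist sub len c d1 in \<open>auto simp: c_def\<close>)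
  \<comment> \<open>Each phase makes as many placements as it has targets. Hence every site is set,
    and \<open>the\<close> in \<open>queue_act_order\<close> never meets
    \<open>None\<close>.\<close>
  have "dom v1 \<inter> ?T = ?T" using v1 cT len by (intro card_subset_eq) auto
  then have def1: "\<exists>i\<in>set (drop c js). v2 j = Some (u i + 1)" if "j \<in> ?T" for j
    using that v1 v2 by (metis (no_types, lifting) DiffD2 IntE domIff imageE not_None_eq set_rev)
  have "dom v2 \<inter> q = q" using v2 c len fin by (intro card_subset_eq) (auto simp: c_def)
  then have def2: "\<exists>i\<in>set (take c js). v2 j = Some (u i)" if "j \<in> q" for j
    using that v2 by (metis (no_types, lifting) IntE domIff imageE not_None_eq)
  have pos: "u i \<ge> 1" if "i \<in> {1..n}" for i using u that by (auto simp: words_def PiE_def)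
  have vq: "\<exists>i\<in>set (take c js). v j = u i" if "j \<in> q" for j
    using def2[OF that] q that v by auto
  have vT: "\<exists>i\<in>set (drop c js). v j = u i + 1" if "j \<in> ?T" for j
    using def1[OF that] that v by auto
  show "v \<in> words n"
    unfolding words_def
  proof (rule PiE_I)
    fix j assume j: "j \<in> {1..n}"
    show "v j \<in> {1..}"
      using vq[of j] vT[of j] j pos sub by (cases "j \<in> q") force+
  qed (auto simp: v)
  obtain xs ys where s: "js = xs @ ys" "set xs = level n u k" "set ys = {1..n} - level n u k"
    "length xs = card (level n u k)"
    using sorted_level_split[OF js] .
  have ys: "k < u j" if "j \<in> set ys" for j using that s(3) by (auto simp: level_def)
  have xs: "u j \<le> k" if "j \<in> set xs" for j using that s(2) by (auto simp: level_def)
  show "serve n (level n u k) q (level n v k)" if "card (level n u k) < card q"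
  proof -
    \<comment> \<open>The level set \<open>xs\<close> is an initial segment of Phase II, and Phase I
      only treats letters above \<open>k\<close>.\<close>
    have tk: "take c js = xs @ take (c - length xs) ys" using that s(1,4) by (simp add: c_def)
    have "drop c js = drop (c - length xs) ys" using that s(1,4) by (simp add: c_def)
    then have dr: "set (drop c js) \<subseteq> set ys" by (simp add: set_drop_subset)
    have "serve n (set xs) q {j \<in> q. \<exists>a. v2 j = Some a \<and> a \<le> k}"
      unfolding v2_def tk
    proof (rule greedy_fold_split[where N = "{1..n}"])
      show "set (xs @ take (c - length xs) ys) \<subseteq> {1..n}" "distinct (xs @ take (c - length xs) ys)"
        using sub(2) dist(2) by (simp_all add: tk)
      show "length (xs @ take (c - length xs) ys) \<le> card q" using tk by (metis c_def length_take min.cobounded2)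
      show "\<not> u y \<le> k" if "y \<in> set (take (c - length xs) ys)" for y
        using ys that by (meson in_set_takeD not_le)
    qed (use serve_empty q fin step2 first_right(1) d1 xs in auto)
    moreover have "{j \<in> q. \<exists>a. v2 j = Some a \<and> a \<le> k} = level n v k"
    proof -
      have "j \<in> q" if "j \<in> level n v k" for j
        using that vT[of j] dr ys by (fastforce simp: level_def)
      moreover have "(\<exists>a. v2 j = Some a \<and> a \<le> k) \<longleftrightarrow> v j \<le> k" if "j \<in> q" for j
        using def2[OF that] q that v by auto
      ultimately show ?thesis using q by (auto simp: level_def)
    qed
    ultimately show ?thesis using s(2) by simp
  qed
  show "level n v (k + 1) = q" if le: "card (level n u k) \<le> card q" "card q \<le> card (level n u (k + 1))"
  proof -
    \<comment> \<open>The cut between the phases falls between levels \<open>k\<close> and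
      \<open>k + 1\<close>: Phase I produces letters above \<open>k + 1\<close>, Phase II letters of
      at most \<open>k + 1\<close>.\<close>
    have "drop c js = drop (c - length xs) ys" using le s(1,4) by (simp add: c_def)
    then have dr: "set (drop c js) \<subseteq> set ys" by (simp add: set_drop_subset)
    obtain xs' ys' where s': "js = xs' @ ys'" "set xs' = level n u (k + 1)"
      "length xs' = card (level n u (k + 1))"
      using sorted_level_split[OF js] by metis
    then have "take c js = take c xs'" using le by (simp add: c_def)
    then have tk: "set (take c js) \<subseteq> level n u (k + 1)" using s'(2) by (metis set_take_subset)
    have "v j \<le> k + 1" if "j \<in> q" for j using vq[OF that] tk by (auto simp: level_def)
    moreover have "v j > k + 1" if "j \<in> ?T" for j using vT[OF that] dr ys by fastforce
    ultimately show ?thesis using q by (force simp: level_def)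
  qed
  show "serve_left n ({1..n} - level n u k) ?T ({1..n} - level n v (k + 1))" if "card q < card (level n u k)"
  proof -
    \<comment> \<open>Phase I runs backwards through the list, so it begins with the complement of
      the level set.\<close>
    have dr: "rev (drop c js) = rev ys @ rev (drop c xs)" using that s(1,4) by (simp add: c_def)
    have "take c js = take c xs" using that s(1,4) by (simp add: c_def)
    then have tk: "set (take c js) \<subseteq> set xs" by (simp add: set_take_subset)
    have "serve_left n (set (rev ys)) ?T {j \<in> ?T. \<exists>a. v1 j = Some a \<and> a > k + 1}"
      unfolding v1_def dr
    proof (rule greedy_fold_split[where N = "{1..n}"])
      show "set (rev ys @ rev (drop c xs)) \<subseteq> {1..n}" "distinct (rev ys @ rev (drop c xs))"
        using sub(1) dist(1) dr by (metis set_rev, metis)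
      show "length (rev ys @ rev (drop c xs)) \<le> card ?T" 
        using arg_cong[OF dr, of length] len cT by simp
      show "\<not> u y + 1 > k + 1" if "y \<in> set (rev (drop c xs))" for y
        using xs[of y] that by (auto dest: in_set_dropD)
    qed (use serve_left_empty step1 first_left(1) ys in auto)
    moreover have "{j \<in> ?T. \<exists>a. v1 j = Some a \<and> a > k + 1} = {1..n} - level n v (k + 1)"
    proof -
      have "j \<notin> q" if "v j > k + 1" for j
        using that vq[of j] tk xs by fastforce
      moreover have "(\<exists>a. v1 j = Some a \<and> a > k + 1) \<longleftrightarrow> v j > k + 1" if "j \<in> ?T" for j
        using def1[OF that] that v v2 by auto
      ultimately have "j \<in> ?T \<and> (\<exists>a. v1 j = Some a \<and> a > k + 1) \<longleftrightarrow> j \<in> {1..n} \<and> v j > k + 1" for j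
        by blast
      moreover have "j \<in> {1..n} - level n v (k + 1) \<longleftrightarrow> j \<in> {1..n} \<and> v j > k + 1" for j
        by (auto simp: level_def)
      ultimately show ?thesis by blast
    qed
    ultimately show ?thesis using s(3) by simp
  qed
qed

text \<open>A full level set has empty complement, so Phase I places nothing beyond it; if the queue
  contains all sites, the queue itself is the full level set.\<close>

lemma queue_act_full:
  assumes u: "u \<in> words n" and q: "q \<subseteq> {1..n}" and full: "level n u k = {1..n}"
  shows "level n (queue_act n q u) (k + 1) = {1..n}"
proof (cases "card q < n")
  case True
  then have "serve_left n {} ({1..n} - q) ({1..n} - level n (queue_act n q u) (k + 1))"
    using queue_act_level_serve_left[OF u q, of k] full by simp
  from serve_left_card[OF this] show ?thesis
    using level_subset[of n "queue_act n q u" "k + 1"] by auto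
next
  case False
  then have qn: "q = {1..n}" using q by (intro card_subset_eq) (auto dest: card_mono[rotated])
  have "level n u (k + 1) = {1..n}"
    using full level_mono[of k "k + 1" n u] level_subset[of n u "k + 1"] by auto
  then show ?thesis using queue_act_level_queue[OF u q, of k] full qn by simp
qed

section \<open>Exchanging two queues\<close>

text \<open>Only such words occur when the queue of size \<open>psum m i\<close> is moved to the front past smaller
  queues, so the Yang-Baxter equation is needed for Phase II only.\<close>

definition low :: "nat \<Rightarrow> nat \<Rightarrow> nat \<Rightarrow> (nat \<Rightarrow> nat) \<Rightarrow> bool" where
  "low n r K u \<longleftrightarrow> K \<ge> 1 \<and> (\<forall>k<K. card (level n u k) < r) \<and> (\<forall>k\<ge>K. level n u k = {1..n})"

lemma queue_act_low:
  assumes u: "u \<in> words n" and q: "q \<subseteq> {1..n}" and low: "low n r K u" and r: "r \<le> card q"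
  shows "k < K \<Longrightarrow> serve n (level n u k) q (level n (queue_act n q u) k)"
    and "level n (queue_act n q u) K = q"
    and "k > K \<Longrightarrow> level n (queue_act n q u) k = {1..n}"
proof -
  show "serve n (level n u k) q (level n (queue_act n q u) k)" if "k < K"
    using that low r by (intro queue_act_level_serve[OF u q]) (auto simp: low_def)
  have "card q \<le> card (level n u K)"
    using low card_mono[OF _ q] by (simp add: low_def)
  moreover have K: "K \<ge> 1" "\<And>k. k < K \<Longrightarrow> card (level n u k) < r" using low by (auto simp: low_def)
  moreover have "card (level n u (K - 1)) \<le> card q"
    using K(1) K(2)[of "K - 1"] r by linarith
  ultimately show "level n (queue_act n q u) K = q"
    using queue_act_level_queue[OF u q, of "K - 1"] by simp
  show "level n (queue_act n q u) k = {1..n}" if "k > K"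
    using queue_act_full[OF u q, of "k - 1"] that low by (simp add: low_def)
qed

text \<open>Phase II keeps the sizes of the levels below \<open>K\<close>, the queue becomes the new
  level \<open>K\<close>, and the full levels start one index later.\<close>

lemma low_queue_act:
  assumes u: "u \<in> words n" and q: "q \<subseteq> {1..n}" and low: "low n r K u" and "r \<le> card q" "card q < s"
  shows "low n s (K + 1) (queue_act n q u)"
proof -
  have "card (level n (queue_act n q u) k) < s" if k: "k < K + 1" for k
  proof (cases "k = K")
    case False
    then have "k < K" using k by simp
    then have "card (level n (queue_act n q u) k) < r"
      using serve_card[OF queue_act_low(1)[OF assms(1-4)]] low by (simp add: low_def)
    then show ?thesis using assms(4,5) by simp
  qed (use queue_act_low(2)[OF assms(1-4)] assms in simp)
  then show ?thesis using queue_act_low(3)[OF assms(1-4)] by (simp add: low_def)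
qed

lemma serve_disjoint:
  assumes "serve n A B B'"
  shows "A \<inter> (B - B') = {}"
proof -
  obtain p where p: "queue_length n A B B' p" and B: "B \<subseteq> {1..n}"
    using assms by (auto simp: serve_def)
  have "t \<notin> A" if t: "t \<in> B - B'" for t
  proof -
    obtain s where s: "t = Suc s" "s < n" using B t by (cases t) auto
    have "p (Suc s) + of_bool (Suc s \<in> B') = p s + of_bool (Suc s \<in> A)" "p (Suc s) = 0"
      using p s t by (auto simp: queue_length_def)
    then show ?thesis using s t by (auto simp: of_bool_def split: if_splits)
  qed
  then show ?thesis by blast
qed

lemma serve_exchange_card:
  assumes "serve n A B B'"
  shows "card (A \<union> (B - B')) = card B"
proof -
  have f: "finite A" "finite B" "B' \<subseteq> B"
    using assms by (auto simp: serve_def intro: finite_subset)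
  then have "card (A \<union> (B - B')) = card A + card (B - B')"
    using serve_disjoint[OF assms] by (intro card_Un_disjoint) auto
  also have "\<dots> = card B' + (card B - card B')"
    using serve_card[OF assms] f by (simp add: card_Diff_subset finite_subset)
  finally show ?thesis using f card_mono[of B B'] by simp
qed

text \<open>The rightward flow from \<open>A\<close> to \<open>B'\<close> and the leftward flow between the complements
  have the same queue lengths, so Phase I undoes the exchange.\<close>

lemma serve_left_exchange:
  assumes "serve n A B B'"
  shows "serve_left n ({1..n} - (A \<union> (B - B'))) ({1..n} - B') ({1..n} - B)"
proof -
  obtain p where p: "queue_length n A B B' p" and sub: "A \<subseteq> {1..n}" "B \<subseteq> {1..n}" "B' \<subseteq> B"
    using assms by (auto simp: serve_def)
  let ?A = "{1..n} - (A \<union> (B - B'))"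
  have mem: "Suc t \<in> mirror n ` S \<longleftrightarrow> Suc (n - Suc t) \<in> S" if "S \<subseteq> {1..n}" "t < n" for S t
  proof -
    have "Suc t = mirror n (Suc (n - Suc t))" using that by (simp add: mirror_def)
    then show ?thesis
      using that inj_on_image_mem_iff[OF inj_on_mirror, of "Suc (n - Suc t)" n S] by simp
  qed
  \<comment> \<open>Under the mirror image the same links are passed in the opposite direction, so
    the lengths are read backwards.\<close>
  have "queue_length n (mirror n ` ?A) (mirror n ` ({1..n} - B')) (mirror n ` ({1..n} - B)) (\<lambda>t. p (n - t))"
    unfolding queue_length_def
  proof (intro conjI allI impI)
    show "p (n - 0) = p (n - n)" using p by (simp add: queue_length_def)
  next
    fix t assume t: "t < n"
    define s where "s = n - Suc t"
    have s: "s < n" "n - t = Suc s" "n - Suc t = s" using t by (auto simp: s_def)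
    have P: "p (Suc s) + of_bool (Suc s \<in> B') = p s + of_bool (Suc s \<in> A)"
      "Suc s \<in> B - B' \<longrightarrow> p (Suc s) = 0"
      using p s by (auto simp: queue_length_def)
    have m: "Suc t \<in> mirror n ` ({1..n} - B) \<longleftrightarrow> Suc s \<notin> B" "Suc t \<in> mirror n ` ({1..n} - B') \<longleftrightarrow> Suc s \<notin> B'"
      "Suc t \<in> mirror n ` ?A \<longleftrightarrow> Suc s \<notin> A \<union> (B - B')"
      using mem[of "{1..n} - B" t] mem[of "{1..n} - B'" t] mem[of ?A t] t s by auto
    have "Suc s \<in> B' \<longrightarrow> Suc s \<in> B" "Suc s \<in> B - B' \<longrightarrow> Suc s \<notin> A" 
      using sub serve_disjoint[OF assms] by auto
    then show "p (n - Suc t) + of_bool (Suc t \<in> mirror n ` ({1..n} - B)) = p (n - t) + of_bool (Suc t \<in> mirror n ` ?A)"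
      unfolding m s using P(1) by (auto simp: of_bool_def split: if_splits)
    show "p (n - Suc t) = 0" if "Suc t \<in> mirror n ` ({1..n} - B') - mirror n ` ({1..n} - B)"
      using that unfolding Diff_iff[of _ "mirror n ` ({1..n} - B')"] m s using P by auto
  qed
  moreover have "mirror n ` S \<subseteq> {1..n}" if "S \<subseteq> {1..n}" for S
    using that by (fastforce simp: mirror_def)
  ultimately show ?thesis
    using sub unfolding serve_left_def serve_def by blast
qed

text \<open>Both words have the same level sets. Below \<open>K\<close> this is the Yang-Baxter
  equation; level \<open>K\<close> is \<open>B'\<close>, as departures of \<open>A\<close> through
  \<open>B\<close> on one side and as inserted queue on the other; level \<open>K + 1\<close> is
  \<open>B\<close>, inserted on one side and recovered from \<open>A'\<close> by Phase I on the
  other.\<close>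

lemma queue_act_exchange:
  assumes u: "u \<in> words n" and low: "low n (card A) K u" and lt: "card A < card B"
    and S: "serve n A B B'"
  shows "queue_act n B (queue_act n A u) = queue_act n B' (queue_act n (A \<union> (B - B')) u)"
proof -
  define A' where "A' = A \<union> (B - B')"
  have sub: "A \<subseteq> {1..n}" "B \<subseteq> {1..n}" "B' \<subseteq> {1..n}" "A' \<subseteq> {1..n}"
    using S by (auto simp: serve_def A'_def)
  have cB': "card B' = card A" using serve_card[OF S] .
  have cA': "card A' = card B" using serve_exchange_card[OF S] by (simp add: A'_def)
  define v where "v = queue_act n A u"
  define w where "w = queue_act n A' u"
  define x where "x = queue_act n B v"
  define y where "y = queue_act n B' w"
  have vw: "v \<in> words n" "w \<in> words n"
    using queue_act_words[OF u] sub by (auto simp: v_def w_def)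
  have xy: "x \<in> words n" "y \<in> words n"
    using queue_act_words vw sub by (auto simp: x_def y_def)
  have lowv: "low n (card B) (K + 1) v"
    using low_queue_act[OF u sub(1) low] lt by (simp add: v_def)
  note V = queue_act_low[OF u sub(1) low order.refl, folded v_def]
  have le: "card A \<le> card A'" using lt cA' by simp
  note W = queue_act_low[OF u sub(4) low le, folded w_def]
  note X = queue_act_low[OF vw(1) sub(2) lowv order.refl, folded x_def]
  have K: "K \<ge> 1" "\<And>k. k < K \<Longrightarrow> card (level n u k) < card A" using low by (auto simp: low_def)
  have cW: "card (level n w k) < card B'" if "k < K" for k
    using serve_card[OF W(1)] K that cB' by simp
  have "x = y"
  proof (rule words_eqI[OF xy])
    fix k :: nat
    consider "k < K" | "k = K" | "k = K + 1" | "k > K + 1" by linarith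
    then show "level n x k = level n y k"
    proof cases
      case 1
      have "serve n (level n w k) B' (level n y k)"
        unfolding y_def by (rule queue_act_level_serve[OF vw(2) sub(3) cW[OF 1]])
      then obtain D where D: "serve n (level n u k) A D" "serve n D B (level n y k)"
        using serve_yang_baxter[OF S W(1)[OF 1, unfolded A'_def]] by blast
      have "D = level n v k" using serve_unique[OF D(1) V(1)[OF 1]] K 1 by simp
      moreover have "card (level n v k) < card B"
        using serve_card[OF V(1)[OF 1]] K 1 lt by (metis order.strict_trans)
      ultimately show ?thesis
        using serve_unique[OF X(1)] D(2) 1 by simp
    next
      case 2
      have "serve n A B (level n x K)" using X(1)[of K] V(2) by simp
      then have "level n x K = B'" using serve_unique[OF _ S lt] by blast
      moreover have "level n y (K - 1 + 1) = B'"
        unfolding y_def using cW[of "K - 1"] K W(2) cA' cB' lt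
        by (intro queue_act_level_queue[OF vw(2) sub(3)]) auto
      ultimately show ?thesis using 2 K by simp
    next
      case 3
      have "serve_left n ({1..n} - A') ({1..n} - B') ({1..n} - level n y (K + 1))"
        unfolding y_def using queue_act_level_serve_left[OF vw(2) sub(3), of K] W(2) cA' cB' lt by simp
      moreover have "card ({1..n} - A') < card ({1..n} - B')"
        using sub cA' cB' lt card_mono[OF _ sub(2)] finite_subset[OF sub(3)] finite_subset[OF sub(4)]
        by (simp add: card_Diff_subset)
      ultimately have "{1..n} - level n y (K + 1) = {1..n} - B"
        using serve_left_unique serve_left_exchange[OF S, folded A'_def] by blast
      then have "level n y (K + 1) = B" using level_subset[of n y "K + 1"] sub(2) by blast
      then show ?thesis using X(2) 3 by simp
    next
      case 4
      then have "level n y (k - 1 + 1) = {1..n}"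
        unfolding y_def using W(3)[of "k - 1"] by (intro queue_act_full[OF vw(2) sub(3)]) auto
      then show ?thesis using X(3) 4 by simp
    qed
  qed
  then show ?thesis by (simp add: x_def y_def v_def w_def A'_def)
qed

section \<open>Weighted sums over sequences of queues\<close>

definition queues :: "nat \<Rightarrow> nat \<Rightarrow> nat set set" where
  "queues n r = {q. q \<subseteq> {1..n} \<and> card q = r}"

lemma finite_queues [simp]: "finite (queues n r)"
  by (simp add: queues_def)

definition monom_of :: "nat set \<Rightarrow> mpoly" where
  "monom_of q = (\<Prod>j\<in>q. indet j)"

lemma sum_exchange_queues:
  assumes u: "u \<in> words n" and low: "low n r K u" and rs: "r < s"
  shows "(\<Sum>A\<in>queues n r. \<Sum>B\<in>queues n s. monom_of A * (monom_of B * f (queue_act n B (queue_act n A u))))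
    = (\<Sum>A\<in>queues n s. \<Sum>B\<in>queues n r. monom_of A * (monom_of B * f (queue_act n B (queue_act n A u))))"
proof -
  define dep where "dep A B = (SOME D. serve n A B D)" for A B
  define ex where "ex = (\<lambda>(A, B). (A \<union> (B - dep A B), dep A B))"
  have dep: "serve n A B (dep A B)" if "(A, B) \<in> queues n r \<times> queues n s" for A B
    unfolding dep_def
    by (rule someI_ex, rule serve_exists) (use that rs in \<open>auto simp: queues_def\<close>)
  have into: "ex ` (queues n r \<times> queues n s) \<subseteq> queues n s \<times> queues n r"
  proof
    fix z assume "z \<in> ex ` (queues n r \<times> queues n s)"
    then obtain A B where AB: "(A, B) \<in> queues n r \<times> queues n s" "z = ex (A, B)" by auto
    show "z \<in> queues n s \<times> queues n r"
      using AB serve_card[OF dep[OF AB(1)]] serve_exchange_card[OF dep[OF AB(1)]] dep[OF AB(1)]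
      by (auto simp: queues_def ex_def serve_def)
  qed
  have inj: "inj_on ex (queues n r \<times> queues n s)"
  proof (rule inj_onI, clarify)
    fix A1 B1 A2 B2
    assume m: "A1 \<in> queues n r" "B1 \<in> queues n s" "A2 \<in> queues n r" "B2 \<in> queues n s"
      and eq: "ex (A1, B1) = ex (A2, B2)"
    define A' B' where "A' = A1 \<union> (B1 - dep A1 B1)" and "B' = dep A1 B1"
    have S: "serve n A1 B1 B'" "serve n A2 B2 B'"
      and A': "A' = A1 \<union> (B1 - B')" "A' = A2 \<union> (B2 - B')"
      using dep[of A1 B1] dep[of A2 B2] m eq by (auto simp: A'_def B'_def ex_def)
    have sub: "A' \<subseteq> {1..n}" "B' \<subseteq> {1..n}" "B1 \<subseteq> {1..n}" "B2 \<subseteq> {1..n}"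
      using S A'(1) by (auto simp: serve_def)
    have "card A' = s" "card B' = r"
      using serve_exchange_card[OF S(1)] serve_card[OF S(1)] m by (auto simp: queues_def A')
    moreover have "s \<le> n" using m(2) card_mono[of "{1..n}" B1] by (auto simp: queues_def)
    ultimately have "card ({1..n} - A') < card ({1..n} - B')"
      using rs sub finite_subset[OF sub(1)] finite_subset[OF sub(2)] by (simp add: card_Diff_subset)
    then have "{1..n} - B1 = {1..n} - B2"
      using serve_left_unique serve_left_exchange[OF S(1), folded A'(1)]
        serve_left_exchange[OF S(2), folded A'(2)] by blast
    then have B: "B1 = B2" using sub by blast
    have "A1 = A' - (B1 - B')" using serve_disjoint[OF S(1)] A'(1) by blast
    moreover have "A2 = A' - (B2 - B')" using serve_disjoint[OF S(2)] A'(2) by blast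
    ultimately show "A1 = A2 \<and> B1 = B2" using B by simp
  qed
  \<comment> \<open>Source and target have equally many elements, so injectivity suffices.\<close>
  have bij: "bij_betw ex (queues n r \<times> queues n s) (queues n s \<times> queues n r)"
    unfolding bij_betw_def
  proof (intro conjI inj card_subset_eq into)
    show "card (ex ` (queues n r \<times> queues n s)) = card (queues n s \<times> queues n r)"
      by (simp add: card_image[OF inj])
  qed simp
  define F where "F = (\<lambda>(A, B). monom_of A * (monom_of B * f (queue_act n B (queue_act n A u))))"
  have "F (ex z) = F z" if z: "z \<in> queues n r \<times> queues n s" for z
  proof -
    obtain A B where AB: "z = (A, B)" by (cases z)
    define B' where "B' = dep A B"
    have S: "serve n A B B'" using dep z AB by (simp add: B'_def)
    have c: "card A = r" "card B = s" using z AB by (auto simp: queues_def)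
    have f: "finite A" "finite B" "B' \<subseteq> B" using S by (auto simp: serve_def intro: finite_subset)
    have "monom_of (A \<union> (B - B')) = monom_of A * monom_of (B - B')"
      unfolding monom_of_def using f serve_disjoint[OF S] by (intro prod.union_disjoint) auto
    moreover have "monom_of B = monom_of (B - B') * monom_of B'"
      unfolding monom_of_def using f by (intro prod.subset_diff) auto
    moreover have "queue_act n B (queue_act n A u) = queue_act n B' (queue_act n (A \<union> (B - B')) u)"
      using queue_act_exchange[OF u _ _ S] low rs c by simp
    ultimately show ?thesis by (simp add: AB F_def ex_def B'_def mult_ac)
  qed
  then have "(\<Sum>z\<in>queues n r \<times> queues n s. F z) = (\<Sum>z\<in>queues n r \<times> queues n s. F (ex z))"
    by (intro sum.cong) auto
  also have "\<dots> = (\<Sum>z\<in>queues n s \<times> queues n r. F z)"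
    by (rule sum.reindex_bij_betw[OF bij])
  finally show ?thesis unfolding sum.cartesian_product F_def .
qed

text \<open>The sizes may come in any order, unlike in an MLQ, so that queues can be permuted. The
  test function \<open>f\<close> on the final word generalises the indicator of a single
  word.\<close>

primrec weight_sum :: "nat \<Rightarrow> nat list \<Rightarrow> (nat \<Rightarrow> nat) \<Rightarrow> ((nat \<Rightarrow> nat) \<Rightarrow> mpoly) \<Rightarrow> mpoly" where
  "weight_sum n [] w f = f w"
| "weight_sum n (r # rs) w f = (\<Sum>q\<in>queues n r. monom_of q * weight_sum n rs (queue_act n q w) f)"

lemma weight_sum_swap:
  assumes "u \<in> words n" "low n r K u" "r < s"
  shows "weight_sum n (r # s # rs) u f = weight_sum n (s # r # rs) u f"
  using sum_exchange_queues[OF assms, of "\<lambda>w. weight_sum n rs w f"] by (simp add: sum_distrib_left)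

text \<open>By induction \<open>s\<close> moves to just behind the first size \<open>t\<close>, and
  one swap completes the move. The bound \<open>r\<close> keeps the word \<open>low\<close> for all
  sizes still to be applied.\<close>

lemma weight_sum_move_front:
  assumes "u \<in> words n" "low n r K u" "sorted_wrt (<) (rs @ [s])" "\<forall>t\<in>set (rs @ [s]). r \<le> t"
  shows "weight_sum n (rs @ s # ts) u f = weight_sum n (s # rs @ ts) u f"
  using assms
proof (induction rs arbitrary: r K u)
  case (Cons t rs)
  have low: "low n t K u"
    using Cons.prems(2,4) by (auto simp: low_def intro: order.strict_trans2)
  have "weight_sum n (rs @ s # ts) (queue_act n q u) f = weight_sum n (s # rs @ ts) (queue_act n q u) f"
    if q: "q \<in> queues n t" for q
  proof (rule Cons.IH)
    show "queue_act n q u \<in> words n" using queue_act_words Cons.prems(1) q by (simp add: queues_def)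
    \<comment> \<open>The sizes increase strictly, so all later ones are at least
      \<open>Suc t\<close>.\<close>
    show "low n (Suc t) (K + 1) (queue_act n q u)"
      using low_queue_act[OF Cons.prems(1) _ low] q by (simp add: queues_def)
  qed (use Cons.prems in auto)
  then have "weight_sum n ((t # rs) @ s # ts) u f = weight_sum n (t # s # rs @ ts) u f"
    by simp
  also have "\<dots> = weight_sum n (s # t # rs @ ts) u f"
    using weight_sum_swap[OF Cons.prems(1) low] Cons.prems(3) by simp
  finally show ?case by simp
qed simp

lemma weight_sum_sum:
  assumes "finite S"
  shows "weight_sum n rs w (\<lambda>x. \<Sum>u\<in>S. f u x) = (\<Sum>u\<in>S. weight_sum n rs w (f u))"
  by (induction rs arbitrary: w) (simp_all add: sum_distrib_left sum.swap[of _ S])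

section \<open>Merging\<close>

lemma merge_word_words: "u \<in> words n \<Longrightarrow> i \<ge> 1 \<Longrightarrow> merge_word n i u \<in> words n"
  by (force simp: words_def merge_word_def PiE_def Pi_def)

text \<open>Merging at \<open>c\<close> deletes the level set with index \<open>c\<close> and closes
  the gap.\<close>

lemma level_merge_word: "level n (merge_word n c u) k = level n u (if k < c then k else k + 1)"
  by (auto simp: level_def merge_word_def)

text \<open>Phase I alone decides this level, and its outcome is unique.\<close>

lemma level_queue_act_cong_below:
  assumes u: "u \<in> words n" "w \<in> words n" and q: "q \<subseteq> {1..n}"
    and eq: "level n u k = level n w l" and lt: "card q < card (level n u k)"
  shows "level n (queue_act n q u) (k + 1) = level n (queue_act n q w) (l + 1)"
proof -
  have "serve_left n ({1..n} - level n u k) ({1..n} - q) ({1..n} - level n (queue_act n q u) (k + 1))"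
    "serve_left n ({1..n} - level n u k) ({1..n} - q) ({1..n} - level n (queue_act n q w) (l + 1))"
    using queue_act_level_serve_left[OF u(1) q, of k] queue_act_level_serve_left[OF u(2) q, of l] eq lt
    by simp_all
  moreover have "card ({1..n} - level n u k) < card ({1..n} - q)"
    using lt q level_subset[of n u k] card_mono[OF _ level_subset[of n u k]] finite_subset[OF q]
    by (simp add: card_Diff_subset)
  ultimately have "{1..n} - level n (queue_act n q u) (k + 1) = {1..n} - level n (queue_act n q w) (l + 1)"
    using serve_left_unique by blast
  then show ?thesis
    using level_subset[of n "queue_act n q u" "k + 1"] level_subset[of n "queue_act n q w" "l + 1"] by blast
qed

text \<open>A new level depends only on two neighbouring old ones, not on their index. This allows a
  comparison with merged words, whose indices are shifted.\<close>

lemma level_queue_act_cong: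
  assumes u: "u \<in> words n" "w \<in> words n" and q: "q \<subseteq> {1..n}"
    and "level n u k = level n w l" and "level n u (k + 1) = level n w (l + 1)"
  shows "level n (queue_act n q u) (k + 1) = level n (queue_act n q w) (l + 1)"
proof -
  consider "card (level n u (k + 1)) < card q" | "card q < card (level n u k)"
    | "card (level n u k) \<le> card q" "card q \<le> card (level n u (k + 1))" by linarith
  then show ?thesis
  proof cases
    case 1
    then have "serve n (level n u (k + 1)) q (level n (queue_act n q u) (k + 1))"
      "serve n (level n u (k + 1)) q (level n (queue_act n q w) (l + 1))"
      using queue_act_level_serve[OF u(1) q, of "k + 1"] queue_act_level_serve[OF u(2) q, of "l + 1"] assms(5)
      by simp_all
    then show ?thesis using serve_unique 1 by blast
  next
    case 2
    then show ?thesis using level_queue_act_cong_below[OF u q assms(4)] by blast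
  next
    case 3
    then show ?thesis
      using queue_act_level_queue[OF u(1) q, of k] queue_act_level_queue[OF u(2) q, of l] assms(4,5) by simp
  qed
qed

text \<open>The level deleted by the merge goes through Phase I, so its index rises to
  \<open>c + 1\<close>. All other new levels arise from the same neighbours before and after
  merging, except the one with index \<open>c\<close>.\<close>

lemma merge_queue_act_below:
  assumes w: "w \<in> words n" and q: "q \<subseteq> {1..n}" and c: "c \<ge> 1" and lt: "card q < card (level n w c)"
  shows "merge_word n (c + 1) (queue_act n q w) = queue_act n q (merge_word n c w)"
    and "card (level n (queue_act n q w) (c + 1)) = card (level n w c)"
proof -
  let ?m = "merge_word n c w"
  have m: "?m \<in> words n" using merge_word_words w c by blast
  show "merge_word n (c + 1) (queue_act n q w) = queue_act n q ?m"
  proof (rule words_eqI)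
    show "merge_word n (c + 1) (queue_act n q w) \<in> words n" "queue_act n q ?m \<in> words n"
      using merge_word_words queue_act_words w m q by simp_all
  next
    fix k :: nat assume "k \<ge> 1"
    then obtain l where k: "k = l + 1" by (metis le_add_diff_inverse2)
    consider "l + 1 < c" | "l + 1 = c" | "l \<ge> c" by linarith
    then show "level n (merge_word n (c + 1) (queue_act n q w)) k = level n (queue_act n q ?m) k"
    proof cases
      case 1
      then show ?thesis
        using level_queue_act_cong[OF w m q, of l l] by (simp add: level_merge_word k)
    next
      case 2
      \<comment> \<open>The lower neighbour is the same for both words, the upper one is not. Either
        Phase I uses only the lower one, or the queue fits between and is itself the new
        level.\<close>
      have mono: "card (level n w c) \<le> card (level n w (c + 1))" by (rule card_level_mono) simp
      show ?thesis
      proof (cases "card q < card (level n w l)")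
        case True
        then have "level n (queue_act n q w) (l + 1) = level n (queue_act n q ?m) (l + 1)"
          using level_queue_act_cong_below[OF w m q, of l l] 2 by (simp add: level_merge_word)
        then show ?thesis using 2 by (simp add: level_merge_word k)
      next
        case False
        then have "level n (queue_act n q w) (l + 1) = q"
          using queue_act_level_queue[OF w q, of l] lt 2 by simp
        moreover have "level n (queue_act n q ?m) (l + 1) = q"
          using queue_act_level_queue[OF m q, of l] lt 2 False mono by (simp add: level_merge_word)
        ultimately show ?thesis using 2 by (simp add: level_merge_word k)
      qed
    next
      case 3
      then show ?thesis
        using level_queue_act_cong[OF w m q, of "l + 1" l] by (simp add: level_merge_word k)
    qed
  qed
  have "serve_left n ({1..n} - level n w c) ({1..n} - q) ({1..n} - level n (queue_act n q w) (c + 1))"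
    using queue_act_level_serve_left[OF w q] lt by blast
  from serve_left_card[OF this]
  have "n - card (level n (queue_act n q w) (c + 1)) = n - card (level n w c)"
    by (simp only: card_Diff_subset[OF finite_level level_subset] card_atLeastAtMost diff_Suc_1)
  moreover have "card (level n x k) \<le> n" for x k
    using card_mono[OF _ level_subset[of n x k]] by simp
  ultimately show "card (level n (queue_act n q w) (c + 1)) = card (level n w c)"
    by (metis diff_diff_cancel)
qed

text \<open>Here the deleted level goes through Phase II and keeps its index. In the exceptional
  case only the upper neighbour is shared, and either Phase II uses only this one or the queue is
  the new level.\<close>

lemma merge_queue_act_above:
  assumes w: "w \<in> words n" and q: "q \<subseteq> {1..n}" and c: "c \<ge> 1" and lt: "card (level n w c) < card q"
  shows "merge_word n c (queue_act n q w) = queue_act n q (merge_word n c w)"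
    and "card (level n (queue_act n q w) c) = card (level n w c)"
proof -
  let ?m = "merge_word n c w"
  have m: "?m \<in> words n" using merge_word_words w c by blast
  show "merge_word n c (queue_act n q w) = queue_act n q ?m"
  proof (rule words_eqI)
    show "merge_word n c (queue_act n q w) \<in> words n" "queue_act n q ?m \<in> words n"
      using merge_word_words queue_act_words w m q c by simp_all
  next
    fix k :: nat assume "k \<ge> 1"
    then obtain l where k: "k = l + 1" by (metis le_add_diff_inverse2)
    consider "l + 1 < c" | "l + 1 = c" | "l \<ge> c" by linarith
    then show "level n (merge_word n c (queue_act n q w)) k = level n (queue_act n q ?m) k"
    proof cases
      case 1
      then show ?thesis
        using level_queue_act_cong[OF w m q, of l l] by (simp add: level_merge_word k)
    next
      case 2
      have mono: "card (level n w l) \<le> card (level n w c)" using 2 by (intro card_level_mono) simp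
      show ?thesis
      proof (cases "card (level n w (c + 1)) < card q")
        case True
        have "serve n (level n w (c + 1)) q (level n (queue_act n q w) (c + 1))"
          "serve n (level n w (c + 1)) q (level n (queue_act n q ?m) c)"
          using queue_act_level_serve[OF w q, of "c + 1"] queue_act_level_serve[OF m q, of c] True
          by (simp_all add: level_merge_word)
        then show ?thesis using serve_unique[OF _ _ True] 2 by (simp add: level_merge_word k)
      next
        case False
        then have "level n (queue_act n q w) (c + 1) = q"
          using queue_act_level_queue[OF w q, of c] lt by simp
        moreover have "level n (queue_act n q ?m) (l + 1) = q"
          using queue_act_level_queue[OF m q, of l] lt 2 False mono by (simp add: level_merge_word)
        ultimately show ?thesis using 2 by (simp add: level_merge_word k)
      qed
    next
      case 3
      then show ?thesis
        using level_queue_act_cong[OF w m q, of "l + 1" l] by (simp add: level_merge_word k)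
    qed
  qed
  show "card (level n (queue_act n q w) c) = card (level n w c)"
    using serve_card[OF queue_act_level_serve[OF w q lt]] .
qed

text \<open>The level of size \<open>s\<close> is followed through all queues. Its size persists,
  its index rises by one at each queue smaller than \<open>s\<close>, and since no queue has size
  \<open>s\<close>, one of the two commutation rules always applies.\<close>

lemma weight_sum_merge:
  assumes "w \<in> words n" "c \<ge> 1" "card (level n w c) = s" "s \<notin> set rs"
    and "\<And>x. x \<in> words n \<Longrightarrow> card (level n x (c + length (filter (\<lambda>r. r < s) rs))) = s \<Longrightarrow>
      f x = g (merge_word n (c + length (filter (\<lambda>r. r < s) rs)) x)"
  shows "weight_sum n rs w f = weight_sum n rs (merge_word n c w) g"
  using assms
proof (induction rs arbitrary: w c)
  case (Cons r rs)
  have "weight_sum n rs (queue_act n q w) f = weight_sum n rs (queue_act n q (merge_word n c w)) g"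
    if "q \<in> queues n r" for q
  proof -
    have q: "q \<subseteq> {1..n}" "card q = r" using that by (auto simp: queues_def)
    have v: "queue_act n q w \<in> words n" using queue_act_words Cons.prems(1) q by blast
    show ?thesis
    proof (cases "r < s")
      case True
      then have lt: "card q < card (level n w c)" using q Cons.prems(3) by simp
      note M = merge_queue_act_below[OF Cons.prems(1) q(1) Cons.prems(2) lt]
      show ?thesis
        unfolding M(1)[symmetric]
        by (rule Cons.IH[OF v]) (use Cons.prems M(2) True in auto)
    next
      case False
      then have lt: "card (level n w c) < card q" using q Cons.prems(3,4) by simp
      note M = merge_queue_act_above[OF Cons.prems(1) q(1) Cons.prems(2) lt]
      show ?thesis
        unfolding M(1)[symmetric]
        by (rule Cons.IH[OF v]) (use Cons.prems M(2) False in auto)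
    qed
  qed
  then show ?case by simp
qed simp

section \<open>Spectral weights\<close>

abbreviation queue_lists :: "nat \<Rightarrow> nat list \<Rightarrow> nat set list set" where
  "queue_lists n rs \<equiv> {qs. list_all2 (\<lambda>q r. q \<in> queues n r) qs rs}"

lemma queue_lists_Cons:
  "queue_lists n (r # rs) = (\<lambda>(q, qs). q # qs) ` (queues n r \<times> queue_lists n rs)"
  by (auto simp: list_all2_Cons2)

lemma finite_queue_lists: "finite (queue_lists n rs)"
  by (induction rs) (simp_all add: queue_lists_Cons del: list_all2_Cons2)

lemma sum_queue_lists:
  "(\<Sum>qs\<in>queue_lists n rs. wt qs * f (mlq_act n qs w)) = weight_sum n rs w f"
proof (induction rs arbitrary: w)
  case Nil
  then show ?case by (simp add: wt_def mlq_act_def)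
next
  case (Cons r rs)
  have inj: "inj_on (\<lambda>(q, qs). q # qs) (queues n r \<times> queue_lists n rs)"
    by (auto simp: inj_on_def)
  have "(\<Sum>qs\<in>queue_lists n (r # rs). wt qs * f (mlq_act n qs w))
      = (\<Sum>(q, qs)\<in>queues n r \<times> queue_lists n rs. monom_of q * (wt qs * f (mlq_act n qs (queue_act n q w))))"
    unfolding queue_lists_Cons sum.reindex[OF inj]
    by (auto simp: wt_def mlq_act_def monom_of_def mult.assoc intro!: sum.cong)
  also have "\<dots> = (\<Sum>q\<in>queues n r. monom_of q * weight_sum n rs (queue_act n q w) f)"
    by (simp add: sum.cartesian_product[symmetric] sum_distrib_left[symmetric] Cons.IH)
  finally show ?case by simp
qed

lemma mlqs_eq: "mlqs n m = queue_lists n (map (psum m) [1..<num_classes m])"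
proof -
  have "(\<forall>k\<in>{1..<l}. P k) \<longleftrightarrow> (\<forall>i<l - 1. P (Suc i))" for l :: nat and P
  proof safe
    fix k assume "\<forall>i<l - 1. P (Suc i)" "k \<in> {1..<l}"
    then show "P k" by (cases k) auto
  qed auto
  then show ?thesis
    by (auto simp: mlqs_def list_all2_conv_all_nth queues_def)
qed

lemma spectral_weight_eq:
  "spectral_weight n u =
    weight_sum n (map (psum (word_type n u)) [1..<num_classes (word_type n u)]) (ones n) (\<lambda>w. of_bool (w = u))"
  unfolding spectral_weight_def mlqs_eq sum_queue_lists[symmetric]
  by (subst sum.inter_filter[OF finite_queue_lists]) (auto intro!: sum.cong)

lemma ones_words: "ones n \<in> words n"
  by (auto simp: ones_def words_def)

lemma level_ones: "level n (ones n) k = (if k = 0 then {} else {1..n})"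
  by (auto simp: level_def ones_def)

lemma low_ones: "r \<ge> 1 \<Longrightarrow> low n r 1 (ones n)"
  by (auto simp: low_def level_ones)

text \<open>The first queue becomes level \<open>1\<close>, and level \<open>2\<close> is full;
  deleting level \<open>1\<close> leaves only full levels.\<close>

lemma merge_word_queue_act_ones:
  assumes "q \<in> queues n r" "r \<ge> 1"
  shows "merge_word n 1 (queue_act n q (ones n)) = ones n"
    and "card (level n (queue_act n q (ones n)) 1) = r"
proof -
  have q: "q \<subseteq> {1..n}" "card q = r" using assms by (auto simp: queues_def)
  note L = queue_act_low[OF ones_words q(1) low_ones[OF assms(2)]]
  show "card (level n (queue_act n q (ones n)) 1) = r" using L(2) q by simp
  show "merge_word n 1 (queue_act n q (ones n)) = ones n"
  proof (rule words_eqI)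
    show "merge_word n 1 (queue_act n q (ones n)) \<in> words n"
      using merge_word_words queue_act_words ones_words q by simp
  qed (use L(3) q ones_words in \<open>simp_all add: level_merge_word level_ones\<close>)
qed

section \<open>Types in terms of level sizes\<close>

lemma card_level_eq_psum:
  assumes "u \<in> words n"
  shows "card (level n u k) = psum (word_type n u) k"
proof (induction k)
  case 0
  then show ?case using level_0[OF assms] by (simp add: psum_def)
next
  case (Suc k)
  have "level n u (Suc k) = level n u k \<union> {j \<in> {1..n}. u j = Suc k}"
    by (auto simp: level_def)
  then have "card (level n u (Suc k)) = card (level n u k) + word_type n u (Suc k)"
    by (subst word_type_def, simp, subst card_Un_disjoint) (auto simp: level_def)
  then show ?case using Suc by (simp add: psum_def)
qed

lemma psum_merge_type:
  assumes "i \<ge> 1"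
  shows "psum (merge_type i m) k = psum m (if k < i then k else k + 1)"
proof (induction k)
  case 0
  then show ?case using assms by (simp add: psum_def)
next
  case (Suc k)
  then show ?case using assms by (auto simp: psum_def merge_type_def)
qed

text \<open>A type is determined by its partial sums. The merged word supplies all of them but the
  one with index \<open>i\<close>, which the size of level \<open>i\<close> supplies.\<close>

lemma word_type_merge_word:
  assumes u: "u \<in> words n" and i: "i \<ge> 1" and v: "merge_word n i u = v"
    and t: "word_type n v = merge_type i m" and c: "card (level n u i) = psum m i"
  shows "word_type n u = m"
proof -
  have vw: "v \<in> words n" using merge_word_words u i v by blast
  have P: "psum (word_type n u) k = psum m k" for k
  proof -
    consider "k < i" | "k = i" | "k > i" by linarith
    then show ?thesis
    proof cases
      case 1
      have "psum (word_type n u) k = card (level n v k)"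
        using 1 v card_level_eq_psum[OF u, of k] by (auto simp: level_merge_word)
      then show ?thesis using card_level_eq_psum[OF vw] t psum_merge_type[OF i] 1 by simp
    next
      case 2
      then show ?thesis using c card_level_eq_psum[OF u] by simp
    next
      case 3
      then obtain l where l: "k = l + 1" "l \<ge> i" by (cases k) auto
      have "psum (word_type n u) k = card (level n v l)"
        using l v card_level_eq_psum[OF u, of k] by (auto simp: level_merge_word)
      then show ?thesis using card_level_eq_psum[OF vw] t psum_merge_type[OF i] l by simp
    qed
  qed
  have "word_type n u k = m k" if "k \<ge> 1" for k
    using P[of k] P[of "k - 1"] that by (cases k) (auto simp: psum_def)
  \<comment> \<open>Partial sums begin at \<open>1\<close>, so the index \<open>0\<close> needs
    separate treatment; merging at \<open>i \<ge> 1\<close> leaves it unchanged.\<close>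
  moreover have "word_type n u 0 = 0"
    using card_level_eq_psum[OF u] level_0[OF u] by (simp add: word_type_def level_def)
  moreover have "m 0 = 0"
  proof -
    have "word_type n v 0 = 0" using level_0[OF vw] by (simp add: word_type_def level_def)
    then show ?thesis using t i by (simp add: merge_type_def)
  qed
  ultimately show ?thesis by (metis ext gr_zeroI less_one not_le)
qed

lemma finite_word_type_support: "finite {k. word_type n u k \<noteq> 0}"
proof (rule finite_subset)
  show "{k. word_type n u k \<noteq> 0} \<subseteq> u ` {1..n}"
    by (auto simp: word_type_def card_eq_0_iff)
qed simp

lemma finite_merge_fibre:
  "finite {u \<in> words n. merge_word n i u = v}"
proof (rule finite_subset)
  show "{u \<in> words n. merge_word n i u = v} \<subseteq> {1..n} \<rightarrow>\<^sub>E (\<Union>j\<in>{1..n}. {v j, v j + 1})"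
    by (force simp: words_def merge_word_def PiE_def Pi_def)
qed (simp add: finite_PiE)

theorem theorem3p5:
  fixes n i :: nat and m v :: "nat \<Rightarrow> nat"
  assumes "n \<ge> 1"
    and "i \<ge> 1" and "m i \<noteq> 0" and "m (i + 1) \<noteq> 0"
    and "v \<in> words n" and "packed n v" and "word_type n v = merge_type i m"
  shows "spectral_weight n v * elem_sym n (psum m i) =
    (\<Sum>u \<in> {u \<in> words n. word_type n u = m \<and> merge_word n i u = v}. spectral_weight n u)"
proof -
  define l where "l = num_classes m"
  let ?m = "merge_type i m"
  \<comment> \<open>\<open>num_classes\<close> is a maximum, so the support of \<open>m\<close> has
    to be finite; this is inherited from the type of \<open>v\<close>.\<close>
  have fin': "finite {k. ?m k \<noteq> 0}" using finite_word_type_support[of n v] assms(7) by simp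
  have "{k. m k \<noteq> 0} \<subseteq> {..i} \<union> Suc ` {k. ?m k \<noteq> 0}"
  proof
    fix k assume "k \<in> {k. m k \<noteq> 0}"
    then show "k \<in> {..i} \<union> Suc ` {k. ?m k \<noteq> 0}"
      by (cases k) (auto simp: merge_type_def image_iff)
  qed
  then have fin: "finite {k. m k \<noteq> 0}" using fin' by (meson finite_UnI finite_atMost finite_imageI finite_subset)
  have l: "m l \<noteq> 0" "\<And>k. m k \<noteq> 0 \<Longrightarrow> k \<le> l"
    using Max_in[OF fin] Max_ge[OF fin] assms(3) by (auto simp: l_def num_classes_def)
  then have il: "i + 1 \<le> l" using assms(4) by blast
  have l': "num_classes ?m = l - 1"
    unfolding num_classes_def
  proof (rule Max_eqI[OF fin'])
    show "l - 1 \<in> {k. ?m k \<noteq> 0}" using l(1) il assms(3) by (auto simp: merge_type_def)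
    fix k assume "k \<in> {k. ?m k \<noteq> 0}"
    then show "k \<le> l - 1"
      using l(2)[of "k + 1"] il by (cases "k \<le> i") (auto simp: merge_type_def)
  qed
  \<comment> \<open>Packedness of \<open>v\<close> carries over to \<open>m\<close>; therefore the
    queue sizes \<open>psum m k\<close> increase strictly.\<close>
  have pos: "m k \<noteq> 0" if "1 \<le> k" "k \<le> l" for k
  proof -
    have P: "?m j \<noteq> 0" if "1 \<le> j" "j \<le> l - 1" for j
      using assms(6) that unfolding packed_def assms(7) l' by auto
    consider "k < i" | "k = i" | "k = i + 1" | "k > i + 1" by linarith
    then show ?thesis
    proof cases
      case 4
      then obtain j where "k = j + 1" by (cases k) auto
      then show ?thesis using P[of j] that 4 by (auto simp: merge_type_def)
    qed (use P[of k] that il assms in \<open>auto simp: merge_type_def\<close>)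
  qed
  have psum_mono: "psum m a < psum m b" if "a < b" "b \<le> l" for a b
    using that
  proof (induction b)
    case (Suc b)
    then show ?case using pos[of "Suc b"] by (cases "a = b") (auto simp: psum_def)
  qed simp
  define s where "s = psum m i"
  define rs where "rs = map (psum m) [1..<i]"
  define ts where "ts = map (psum m) [i + 1..<l]"
  have s1: "s \<ge> 1" using psum_mono[of 0 i] assms(2) il by (simp add: s_def psum_def)
  have sorted: "sorted_wrt (<) (rs @ [s])"
  proof -
    have "sorted_wrt (\<lambda>a b. psum m a < psum m b) [1..<i]"
      by (rule sorted_wrt_mono_rel[OF _ sorted_wrt_upt])
        (use psum_mono il in auto)
    then show ?thesis using psum_mono il by (auto simp: rs_def s_def sorted_wrt_append sorted_wrt_map)
  qed
  have rs_lt: "\<forall>r\<in>set rs. r < s" using psum_mono il by (auto simp: rs_def s_def)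
  have ts_gt: "\<forall>r\<in>set ts. s < r" using psum_mono by (auto simp: ts_def s_def)
  have rs1: "\<forall>r\<in>set (rs @ [s]). 1 \<le> r"
  proof -
    have "1 \<le> psum m k" if "1 \<le> k" "k \<le> l" for k
      using psum_mono[of 0 k] that by linarith
    then show ?thesis using il s1 by (auto simp: rs_def)
  qed
  \<comment> \<open>The \<open>i - 1\<close> smaller queues will raise the merged level from index
    \<open>1\<close> to index \<open>i\<close>.\<close>
  have count: "length (filter (\<lambda>r. r < s) (rs @ ts)) = i - 1"
  proof -
    have "filter (\<lambda>r. r < s) rs = rs" "filter (\<lambda>r. r < s) ts = []"
      using rs_lt ts_gt by (auto simp: filter_empty_conv dest: order.asym)
    then show ?thesis by (simp add: rs_def)
  qed
  have "[1..<l] = [1..<i] @ i # [i + 1..<l]"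
    using assms(2) il upt_add_eq_append[of 1 i "l - i"] by (simp add: upt_conv_Cons)
  then have list_m: "map (psum m) [1..<l] = rs @ s # ts" by (simp add: rs_def s_def ts_def)
  have list_m': "map (psum ?m) [1..<l - 1] = rs @ ts"
  proof -
    have "[1..<l - 1] = [1..<i] @ [i..<l - 1]"
      using assms(2) il upt_add_eq_append[of 1 i "l - 1 - i"] by simp
    moreover have "map (psum ?m) [1..<i] = rs"
      using psum_merge_type[OF assms(2)] by (auto simp: rs_def)
    moreover have "map (psum ?m) [i..<l - 1] = map (psum m) (map Suc [i..<l - 1])"
      using psum_merge_type[OF assms(2)] by auto
    moreover have "map Suc [i..<l - 1] = [i + 1..<l]" using il by (simp add: map_Suc_upt)
    ultimately show ?thesis by (simp only: map_append ts_def)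
  qed
  define S where "S = {u \<in> words n. word_type n u = m \<and> merge_word n i u = v}"
  have finS: "finite S"
    by (rule finite_subset[OF _ finite_merge_fibre[of n i v]]) (auto simp: S_def)
  have "(\<Sum>u\<in>S. spectral_weight n u) = (\<Sum>u\<in>S. weight_sum n (rs @ s # ts) (ones n) (\<lambda>w. of_bool (w = u)))"
  proof (rule sum.cong[OF refl])
    fix u assume "u \<in> S"
    then have "word_type n u = m" by (simp add: S_def)
    then show "spectral_weight n u = weight_sum n (rs @ s # ts) (ones n) (\<lambda>w. of_bool (w = u))"
      by (simp only: spectral_weight_eq l_def[symmetric] list_m)
  qed
  \<comment> \<open>The indicators of the words in \<open>S\<close> add up to the indicator of
    \<open>S\<close>.\<close>
  also have "\<dots> = weight_sum n (rs @ s # ts) (ones n) (\<lambda>w. of_bool (w \<in> S))"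
  proof -
    have "(\<Sum>u\<in>S. of_bool (w = u)) = (of_bool (w \<in> S) :: mpoly)" for w
      using finS by (simp add: of_bool_def)
    then show ?thesis unfolding weight_sum_sum[OF finS, symmetric] by simp
  qed
  also have "\<dots> = weight_sum n (s # rs @ ts) (ones n) (\<lambda>w. of_bool (w \<in> S))"
    using weight_sum_move_front[OF ones_words low_ones sorted rs1] by simp
  also have "\<dots> = (\<Sum>q\<in>queues n s. monom_of q * weight_sum n (rs @ ts) (ones n) (\<lambda>w. of_bool (w = v)))"
    unfolding weight_sum.simps
  \<comment> \<open>For each first queue, merging at \<open>1\<close> is pushed through the
    remaining queues: it turns the initial word into \<open>ones n\<close> and the final word into
    its merge at \<open>i\<close>.\<close>
  proof (rule sum.cong[OF refl], rule arg_cong[where f = "(*) _"])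
    fix q assume q: "q \<in> queues n s"
    note M = merge_word_queue_act_ones[OF q s1]
    have "weight_sum n (rs @ ts) (queue_act n q (ones n)) (\<lambda>w. of_bool (w \<in> S))
      = weight_sum n (rs @ ts) (merge_word n 1 (queue_act n q (ones n))) (\<lambda>w. of_bool (w = v))"
    proof (rule weight_sum_merge[where s = s])
      show "queue_act n q (ones n) \<in> words n"
        using q ones_words by (simp add: queue_act_words queues_def)
      show "s \<notin> set (rs @ ts)" using rs_lt ts_gt by auto
      fix x assume x: "x \<in> words n" "card (level n x (1 + length (filter (\<lambda>r. r < s) (rs @ ts)))) = s"
      have ii: "1 + (i - 1) = i" using assms(2) by simp
      have "card (level n x i) = psum m i" using x(2) unfolding count ii by (simp add: s_def)
      \<comment> \<open>The followed level has size \<open>psum m i\<close> at the end, so a final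
        word that merges to \<open>v\<close> automatically has type \<open>m\<close>.\<close>
      then have "x \<in> S \<longleftrightarrow> merge_word n i x = v"
        using word_type_merge_word[OF x(1) assms(2) _ assms(7)] x(1) by (auto simp: S_def)
      then show "of_bool (x \<in> S) = of_bool (merge_word n (1 + length (filter (\<lambda>r. r < s) (rs @ ts))) x = v)"
        unfolding count ii by simp
    qed (use M in auto)
    then show "weight_sum n (rs @ ts) (queue_act n q (ones n)) (\<lambda>w. of_bool (w \<in> S))
      = weight_sum n (rs @ ts) (ones n) (\<lambda>w. of_bool (w = v))"
      unfolding M(1) .
  qed
  \<comment> \<open>The inner sum no longer depends on \<open>q\<close>, so the sum over
    \<open>q\<close> factors out as the elementary symmetric polynomial.\<close>
  also have "\<dots> = spectral_weight n v * elem_sym n s"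
    unfolding spectral_weight_eq assms(7) l' list_m'
    by (simp add: elem_sym_def queues_def monom_of_def sum_distrib_right[symmetric] mult.commute)
  finally show ?thesis by (simp add: S_def s_def)
qed

end
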